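(* Let $E$ be a uniformly smooth and uniformly convex real Banach space with dual $E^{*}$ and normalized duality mapping $J:E\to E^{*}$, and let $C\subset E$ be nonempty, closed and convex such that $JC=\{Jc:c\in C\}$ is closed and convex. Let $\{f_i\}_{i=1}^{\infty}$ be bifunctions $JC\times JC\to\mathbb{R}$ each satisfying conditions (A1)--(A4) (see context), let $\{A_j\}_{j=1}^{\infty}$ be continuous monotone mappings from $C$ into $E^{*}$, and let $\{M_k\}_{k=1}^{\infty}$ be maximal monotone operators from $E$ into $2^{E^{*}}$ such that $G_r^{M_k}(C)\subset C$ for all $r>0$ and $k\in\mathbb{N}$. Let $\{T_n\}_{n=1}^{\infty}$ be generalized $J_{*}$-nonexpansive mappings from $C$ into $E^{*}$, and let $\Gamma$ be a family of $J_{*}$-closed generalized $J_{*}$-nonexpansive mappings from $C$ into $E^{*}$ such that $\bigcap_{n=1}^{\infty}F_J(T_n)=F_J(\Gamma)\neq\emptyset$. Let $\sigma,\tau,\rho:\mathbb N\to\mathbb N$ be maps such that every positive integer occurs infinitely many times in each of $\{\sigma(n)\}$, $\{\tau(n)\}$, $\{\rho(n)\}$. Assume that $$B:=F_J(\Gamma)\cap\Big(\bigcap_{i=1}^{\infty}EP(f_i)\Big)\cap\Big(\bigcap_{j=1}^{\infty}VI(C,A_j)\Big)\cap\Big(\bigcap_{k=1}^{\infty}M_k^{-1}0\Big)$$ is nonempty, closed and convex. Let $\{r_n\}\subset[a,\infty)$ for some $a>0$, and let $\alpha_i\in(0,1)$, $i=1,\dots,5$, satisfy $\sum_{i=1}^{5}\alpha_i=1$.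 Suppose that $\{x_n\}$, with auxiliary sequences $\{z_n\},\{u_n\},\{q_n\},\{y_n\}$, is generated by $x_1=x\in C$, $C_1=C$ and, for all $n\in\mathbb N$, $$\begin{aligned} z_n&=T_{r_n}^{f_{\sigma(n)}}x_n,\qquad u_n=F_{r_n}^{A_{\tau(n)}}x_n,\qquad q_n=G_{r_n}^{M_{\rho(n)}}x_n,\\ y_n&=J^{-1}\big(\alpha_1Jx_n+\alpha_2Jz_n+\alpha_3Ju_n+\alpha_4Jq_n+\alpha_5T_nq_n\big),\\ C_{n+1}&=\{v\in C_n:\phi(v,y_n)\le\phi(v,x_n)\},\\ x_{n+1}&=\Pi_{C_{n+1}}x . \end{aligned}$$ Suppose also that $\{T_n\}$ satisfies the NST-condition with $\Gamma$: for every bounded sequence $\{s_n\}\subset C$, $\|Js_n-T_ns_n\|\to0$ implies $\|Js_n-Ts_n\|\to0$ for all $T\in\Gamma$. Then $$\|x_n-z_n\|\to0,\qquad\|x_n-u_n\|\to0,\qquad\|x_n-q_n\|\to0,\qquad \|Jq_n-T_nq_n\|\to0 .$$ Moreover, for each fixed $i,j,k\in\mathbb N$, along subsequences $\{n_l\},\{m_l\},\{s_l\}$ of indices with $\sigma(n_l)=i$, $\tau(m_l)=j$ and $\rho(s_l)=k$ for all $l$, respectively, one has $$\frac{\|Jz_{n_l}-Jx_{n_l}\|}{r_{n_l}}\to0,\qquad\frac{\|Ju_{m_l}-Jx_{m_l}\|}{r_{m_l}}\to0,\qquad\frac{\|Jx_{s_l}-Jq_{s_l}\|}{r_{s_l}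}\to0\qquad(l\to\infty).$$
   Context: Notation and definitions. $\langle x,x^{*}\rangle$ is the pairing of $x\in E$ with $x^{*}\in E^{*}$. $J$ is the normalized duality mapping: $Jx$ is the unique $x^*\in E^*$ with $\langle x,x^{*}\rangle=\|x\|\|x^{*}\|$ and $\|x^{*}\|=\|x\|$ (single-valued, one-to-one and onto here); $J_{*}=J^{-1}:E^{*}\to E$. The Lyapunov functional is $\phi(x,y)=\|x\|^{2}-2\langle x,Jy\rangle+\|y\|^{2}$ for $x,y\in E$. For $D\subset E$ nonempty, closed and convex, the generalized projection $\Pi_Dx$ is the unique minimizer of $y\mapsto\phi(y,x)$ over $y\in D$. For $T:C\to E^{*}$: $F_J(T)=\{p\in C:Tp=Jp\}$; for a family $\Gamma$ of such maps, $F_J(\Gamma)=\bigcap_{T\in\Gamma}F_J(T)$. $T$ is generalized $J_{*}$-nonexpansive if $F_J(T)\ne\emptyset$ and $\phi(p,(J_{*}\circ T)x)\le\phi(p,x)$ for all $x\in C$, $p\in F_J(T)$. $T$ is $J_{*}$-closed if $x_n\to x$ and $(J_{*}\circ T)x_n\to y$ (with $x_n,x\in C$) imply $y=(J_{*}\circ T)x$. Conditions on $f:JC\times JC\to\mathbb R$: (A1) $f(x^{*},x^{*})=0$ for all $x^*\in JC$; (A2) $f(x^{*},y^{*})+f(y^{*},x^{*})\le0$ for all $x^*,y^*\in JC$; (A3) $\limsup_{t\downarrow0}f(tz^{*}+(1-t)x^{*},y^{*})\le f(x^{*},y^{*})$ for all $x^{*},y^{*},z^{*}\in JC$; (A4)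 for each $x^{*}\in JC$, $f(x^{*},\cdot)$ is convex and lower semicontinuous. Solution sets: $EP(f)=\{x\in C: f(Jx,Jy)\ge0\ \forall y\in C\}$; for $A:C\to E^*$, $VI(C,A)=\{x\in C:\langle y-x,Ax\rangle\ge0\ \forall y\in C\}$; $M^{-1}0=\{x\in E:0\in Mx\}$. $A:C\to E^*$ is monotone if $\langle x-y,Ax-Ay\rangle\ge 0$ for all $x,y\in C$; an operator $M:E\to2^{E^{*}}$ is monotone if $\langle x-y,x^{*}-y^{*}\rangle\ge0$ whenever $x^{*}\in Mx$, $y^{*}\in My$, and maximal monotone if its graph is not properly contained in the graph of another monotone operator. Resolvents ($r>0$, $x\in E$): $T_r^fx$ is the point $z\in C$ with $f(Jz,Jy)+\frac1r\langle y-z,Jz-Jx\rangle\ge0$ for all $y\in C$; $F_r^Ax$ is the point $z\in C$ with $\langle y-z,Az\rangle+\frac1r\langle y-z,Jz-Jx\rangle\ge0$ for all $y\in C$; $G_r^M=(J+rM)^{-1}J$, i.e. $q=G_r^Mx$ iff $\frac{Jx-Jq}{r}\in Mq$. As part of the setting, $T_r^{f_i},F_r^{A_j}:E\to C$ and $G_r^{M_k}:E\to E$ are everywhere-defined single-valued maps. *)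

theory Defs
  imports "HOL-Analysis.Analysis"
begin

text \<open>
  The dual of a real normed space \<open>'a\<close> is \<open>'a \<Rightarrow>\<^sub>L real\<close>, and the pairing of \<open>x\<close> with \<open>xs\<close> is
  \<open>blinfun_apply xs x\<close>.  Maps defined on a subset \<open>C\<close> of \<open>'a\<close> (or on the image of \<open>C\<close> under the
  duality mapping) are total functions of which only the values on that set are ever used.
\<close>

definition uniformly_convex :: "'a::real_normed_vector itself \<Rightarrow> bool" where
  "uniformly_convex _ \<longleftrightarrow>
    (\<forall>\<epsilon>>0. \<exists>\<delta>>0. \<forall>x y :: 'a.
      norm x = 1 \<longrightarrow> norm y = 1 \<longrightarrow> norm (x - y) \<ge> \<epsilon> \<longrightarrow> norm ((1/2) *\<^sub>R (x + y)) \<le> 1 - \<delta>)"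

text \<open>
  With \<open>\<rho> t\<close> the supremum of \<open>(norm (x + y) + norm (x - y)) / 2 - 1\<close> over \<open>norm x = 1\<close>,
  \<open>norm y = t\<close>, the following says that \<open>\<rho> t / t\<close> tends to \<open>0\<close> as \<open>t\<close> tends to \<open>0\<close> from the right.
\<close>

definition uniformly_smooth :: "'a::real_normed_vector itself \<Rightarrow> bool" where
  "uniformly_smooth _ \<longleftrightarrow>
    (\<forall>\<epsilon>>0. \<exists>\<delta>>0. \<forall>x y :: 'a.
      norm x = 1 \<longrightarrow> norm y \<le> \<delta> \<longrightarrow> norm (x + y) + norm (x - y) \<le> 2 + \<epsilon> * norm y)"

definition duality_map :: "'a::real_normed_vector \<Rightarrow> ('a \<Rightarrow>\<^sub>L real)" where
  "duality_map x =
    (THE xs. blinfun_apply xs x = norm x * norm xs \<and> norm xs = norm x)"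

abbreviation duality_inv :: "('a::real_normed_vector \<Rightarrow>\<^sub>L real) \<Rightarrow> 'a" where
  "duality_inv \<equiv> inv duality_map"

definition lyapunov :: "'a::real_normed_vector \<Rightarrow> 'a \<Rightarrow> real" where
  "lyapunov x y = (norm x)\<^sup>2 - 2 * blinfun_apply (duality_map y) x + (norm y)\<^sup>2"

text \<open>The minimisation is in the first argument of \<^const>\<open>lyapunov\<close>.\<close>

definition gen_proj :: "'a::real_normed_vector set \<Rightarrow> 'a \<Rightarrow> 'a" where
  "gen_proj D x = (THE y. is_arg_min (\<lambda>y. lyapunov y x) (\<lambda>y. y \<in> D) y)"

definition J_fixed :: "'a::real_normed_vector set \<Rightarrow> ('a \<Rightarrow> 'a \<Rightarrow>\<^sub>L real) \<Rightarrow> 'a set" where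
  "J_fixed C T = {p \<in> C. T p = duality_map p}"

definition J_fixed_family ::
    "'a::real_normed_vector set \<Rightarrow> ('a \<Rightarrow> 'a \<Rightarrow>\<^sub>L real) set \<Rightarrow> 'a set" where
  "J_fixed_family C \<Gamma> = (\<Inter>T\<in>\<Gamma>. J_fixed C T)"

definition gen_J_nonexpansive ::
    "'a::real_normed_vector set \<Rightarrow> ('a \<Rightarrow> 'a \<Rightarrow>\<^sub>L real) \<Rightarrow> bool" where
  "gen_J_nonexpansive C T \<longleftrightarrow>
    J_fixed C T \<noteq> {} \<and>
    (\<forall>x\<in>C. \<forall>p\<in>J_fixed C T. lyapunov p (duality_inv (T x)) \<le> lyapunov p x)"

definition J_closed :: "'a::real_normed_vector set \<Rightarrow> ('a \<Rightarrow> 'a \<Rightarrow>\<^sub>L real) \<Rightarrow> bool" where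
  "J_closed C T \<longleftrightarrow>
    (\<forall>X x y. (\<forall>n. X n \<in> C) \<longrightarrow> x \<in> C \<longrightarrow> X \<longlonglongrightarrow> x \<longrightarrow>
      (\<lambda>n. duality_inv (T (X n))) \<longlonglongrightarrow> y \<longrightarrow> y = duality_inv (T x))"

text \<open>Lower semicontinuity of \<open>f x\<close> is relative to \<open>K\<close>.\<close>

definition equilibrium_bifunction ::
    "'b::real_normed_vector set \<Rightarrow> ('b \<Rightarrow> 'b \<Rightarrow> real) \<Rightarrow> bool" where
  "equilibrium_bifunction K f \<longleftrightarrow>
    (\<forall>x\<in>K. f x x = 0) \<and>
    (\<forall>x\<in>K. \<forall>y\<in>K. f x y + f y x \<le> 0) \<and>
    (\<forall>x\<in>K. \<forall>y\<in>K. \<forall>z\<in>K.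
      Limsup (at_right 0) (\<lambda>t::real. ereal (f (t *\<^sub>R z + (1 - t) *\<^sub>R x) y)) \<le> ereal (f x y)) \<and>
    (\<forall>x\<in>K. convex_on K (f x) \<and>
      (\<forall>y\<in>K. ereal (f x y) \<le> Liminf (at y within K) (\<lambda>w. ereal (f x w))))"

definition EP :: "'a::real_normed_vector set \<Rightarrow>
    (('a \<Rightarrow>\<^sub>L real) \<Rightarrow> ('a \<Rightarrow>\<^sub>L real) \<Rightarrow> real) \<Rightarrow> 'a set" where
  "EP C f = {x \<in> C. \<forall>y\<in>C. f (duality_map x) (duality_map y) \<ge> 0}"

definition VI :: "'a::real_normed_vector set \<Rightarrow> ('a \<Rightarrow> 'a \<Rightarrow>\<^sub>L real) \<Rightarrow> 'a set" where
  "VI C A = {x \<in> C. \<forall>y\<in>C. blinfun_apply (A x) (y - x) \<ge> 0}"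

definition zeros :: "('a::real_normed_vector \<Rightarrow> ('a \<Rightarrow>\<^sub>L real) set) \<Rightarrow> 'a set" where
  "zeros M = {x. 0 \<in> M x}"

definition monotone_mapping_on :: "'a::real_normed_vector set \<Rightarrow> ('a \<Rightarrow> 'a \<Rightarrow>\<^sub>L real) \<Rightarrow> bool" where
  "monotone_mapping_on C A \<longleftrightarrow> (\<forall>x\<in>C. \<forall>y\<in>C. blinfun_apply (A x - A y) (x - y) \<ge> 0)"

definition monotone_op :: "('a::real_normed_vector \<Rightarrow> ('a \<Rightarrow>\<^sub>L real) set) \<Rightarrow> bool" where
  "monotone_op M \<longleftrightarrow>
    (\<forall>x y. \<forall>xs\<in>M x. \<forall>ys\<in>M y. blinfun_apply (xs - ys) (x - y) \<ge> 0)"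

definition maximal_monotone_op ::
    "('a::real_normed_vector \<Rightarrow> ('a \<Rightarrow>\<^sub>L real) set) \<Rightarrow> bool" where
  "maximal_monotone_op M \<longleftrightarrow>
    monotone_op M \<and> \<not> (\<exists>N. monotone_op N \<and> Sigma UNIV M \<subset> Sigma UNIV N)"

text \<open>
  Each resolvent is given by its defining relation \<open>is_\<dots>_resolvent\<close> and by the function choosing
  the unique related point, which is meaningful only when that point exists and is unique.
\<close>

definition is_EP_resolvent :: "'a::real_normed_vector set \<Rightarrow>
    (('a \<Rightarrow>\<^sub>L real) \<Rightarrow> ('a \<Rightarrow>\<^sub>L real) \<Rightarrow> real) \<Rightarrow> real \<Rightarrow> 'a \<Rightarrow> 'a \<Rightarrow> bool" where
  "is_EP_resolvent C f r x z \<longleftrightarrow>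
    z \<in> C \<and>
    (\<forall>y\<in>C. f (duality_map z) (duality_map y)
      + (1 / r) * blinfun_apply (duality_map z - duality_map x) (y - z) \<ge> 0)"

definition EP_resolvent :: "'a::real_normed_vector set \<Rightarrow>
    (('a \<Rightarrow>\<^sub>L real) \<Rightarrow> ('a \<Rightarrow>\<^sub>L real) \<Rightarrow> real) \<Rightarrow> real \<Rightarrow> 'a \<Rightarrow> 'a" where
  "EP_resolvent C f r x = (THE z. is_EP_resolvent C f r x z)"

definition is_VI_resolvent :: "'a::real_normed_vector set \<Rightarrow>
    ('a \<Rightarrow> 'a \<Rightarrow>\<^sub>L real) \<Rightarrow> real \<Rightarrow> 'a \<Rightarrow> 'a \<Rightarrow> bool" where
  "is_VI_resolvent C A r x z \<longleftrightarrow>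
    z \<in> C \<and>
    (\<forall>y\<in>C. blinfun_apply (A z) (y - z)
      + (1 / r) * blinfun_apply (duality_map z - duality_map x) (y - z) \<ge> 0)"

definition VI_resolvent :: "'a::real_normed_vector set \<Rightarrow>
    ('a \<Rightarrow> 'a \<Rightarrow>\<^sub>L real) \<Rightarrow> real \<Rightarrow> 'a \<Rightarrow> 'a" where
  "VI_resolvent C A r x = (THE z. is_VI_resolvent C A r x z)"

definition is_op_resolvent :: "('a::real_normed_vector \<Rightarrow> ('a \<Rightarrow>\<^sub>L real) set) \<Rightarrow>
    real \<Rightarrow> 'a \<Rightarrow> 'a \<Rightarrow> bool" where
  "is_op_resolvent M r x q \<longleftrightarrow> (1 / r) *\<^sub>R (duality_map x - duality_map q) \<in> M q"

definition op_resolvent :: "('a::real_normed_vector \<Rightarrow> ('a \<Rightarrow>\<^sub>L real) set) \<Rightarrow>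
    real \<Rightarrow> 'a \<Rightarrow> 'a" where
  "op_resolvent M r x = (THE q. is_op_resolvent M r x q)"

text \<open>Sequences are indexed from \<open>1\<close>; their value at \<open>0\<close> is irrelevant.\<close>

definition NST_condition :: "'a::real_normed_vector set \<Rightarrow>
    (nat \<Rightarrow> 'a \<Rightarrow> 'a \<Rightarrow>\<^sub>L real) \<Rightarrow> ('a \<Rightarrow> 'a \<Rightarrow>\<^sub>L real) set \<Rightarrow> bool" where
  "NST_condition C T \<Gamma> \<longleftrightarrow>
    (\<forall>s. (\<forall>n\<ge>1. s n \<in> C) \<longrightarrow> bounded (s ` {1..}) \<longrightarrow>
      (\<lambda>n. norm (duality_map (s n) - T n (s n))) \<longlonglongrightarrow> 0 \<longrightarrow>
      (\<forall>S\<in>\<Gamma>. (\<lambda>n. norm (duality_map (s n) - S (s n))) \<longlonglongrightarrow> 0))"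

end

theory Submission
  imports Defs
begin

text \<open>
  A common point \<open>p \<in> B\<close> satisfies \<open>\<phi>(p, w) + \<phi>(w, x\<^sub>n) \<le> \<phi>(p, x\<^sub>n)\<close> for each of the three
  resolvent points \<open>w\<close>, so convexity of the squared dual norm bounds a positive combination of
  the \<open>\<phi>(w, x\<^sub>n)\<close> by \<open>\<phi>(p, x\<^sub>n) - \<phi>(p, y\<^sub>n)\<close>.  In particular \<open>B\<close> stays inside the nested closed
  convex sets \<open>C\<^sub>n\<close>, hence \<open>\<phi>(x\<^sub>n, x)\<close> is increasing and bounded and \<open>\<phi>(x\<^sub>n\<^sub>+\<^sub>1, x\<^sub>n) \<longlongrightarrow> 0\<close>.
  Since \<open>x\<^sub>n\<^sub>+\<^sub>1 \<in> C\<^sub>n\<^sub>+\<^sub>1\<close>, also \<open>\<phi>(x\<^sub>n\<^sub>+\<^sub>1, y\<^sub>n) \<longlongrightarrow> 0\<close>.  Uniform convexity turns small \<open>\<phi>\<close> into small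
  distance, so \<open>x\<^sub>n - y\<^sub>n \<longlongrightarrow> 0\<close>, the bound above tends to \<open>0\<close>, and each \<open>w - x\<^sub>n \<longlongrightarrow> 0\<close>.  By uniform
  smoothness \<open>J\<close> is uniformly continuous on bounded sets, and solving the definition of \<open>y\<^sub>n\<close> for
  \<open>T\<^sub>n q\<^sub>n\<close> yields the remaining limits.
\<close>

section \<open>The duality mapping of a uniformly smooth space\<close>

text \<open>The relation behind the \<open>THE\<close> in \<open>duality_map\<close>, kept separate
  so that existence and uniqueness can be proved before the description is used.\<close>

definition duality_pair :: "'a::real_normed_vector \<Rightarrow> ('a \<Rightarrow>\<^sub>L real) \<Rightarrow> bool" where
  "duality_pair x f \<longleftrightarrow> blinfun_apply f x = norm x * norm f \<and> norm f = norm x"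

text \<open>Convexity of the norm: \<open>x + s *\<^sub>R h\<close> is a convex combination of
  \<open>x\<close> and \<open>x + t *\<^sub>R h\<close>.\<close>

lemma norm_slope_mono:
  fixes x h :: "'a::real_normed_vector"
  assumes "0 < s" "s \<le> t"
  shows "(norm (x + s *\<^sub>R h) - norm x) / s \<le> (norm (x + t *\<^sub>R h) - norm x) / t"
proof -
  have "t *\<^sub>R (x + s *\<^sub>R h) = (t - s) *\<^sub>R x + s *\<^sub>R (x + t *\<^sub>R h)"
    by (simp add: algebra_simps)
  then have "t * norm (x + s *\<^sub>R h) = norm ((t - s) *\<^sub>R x + s *\<^sub>R (x + t *\<^sub>R h))"
    using assms by (metis abs_of_pos less_le_trans norm_scaleR)
  also have "\<dots> \<le> (t - s) * norm x + s * norm (x + t *\<^sub>R h)"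
    using norm_triangle_ineq[of "(t - s) *\<^sub>R x" "s *\<^sub>R (x + t *\<^sub>R h)"] assms by simp
  finally show ?thesis
    using assms by (simp add: field_simps)
qed

lemma norm_slope_abs_le:
  fixes x h :: "'a::real_normed_vector"
  assumes "0 < t"
  shows "\<bar>(norm (x + t *\<^sub>R h) - norm x) / t\<bar> \<le> norm h"
  using norm_triangle_ineq3[of "x + t *\<^sub>R h" x] assms by (simp add: field_simps)

text \<open>The slopes increase with \<open>t\<close> and are bounded below by
  \<open>- norm h\<close>, so they tend to their infimum.\<close>

lemma norm_slope_tendsto:
  fixes x h :: "'a::real_normed_vector"
  obtains d where "((\<lambda>t. (norm (x + t *\<^sub>R h) - norm x) / t) \<longlongrightarrow> d) (at_right 0)"
proof -
  define q where "q t = (norm (x + t *\<^sub>R h) - norm x) / t" for t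
  define d where "d = (INF t\<in>{0<..}. q t)"
  have bdd: "bdd_below (q ` {0<..})"
    using norm_slope_abs_le[of _ x h] unfolding q_def
    by (intro bdd_belowI2[of _ "- norm h"]) (meson abs_le_iff greaterThan_iff minus_le_iff)
  have "(q \<longlongrightarrow> d) (at_right 0)"
  proof (rule order_tendstoI)
    fix e assume "e < d"
    have "e < q t" if "t > 0" for t
      using cINF_lower[OF bdd, of t] that \<open>e < d\<close> unfolding d_def by simp
    then show "\<forall>\<^sub>F t in at_right 0. e < q t"
      by (auto simp: eventually_at_filter)
  next
    fix e assume "d < e"
    then obtain t where t: "t > 0" "q t < e"
      unfolding d_def using cINF_less_iff[OF _ bdd] by auto
    have "q s < e" if "0 < s" "s < t" for s
      using norm_slope_mono[of s t x h] that t unfolding q_def by simp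
    then show "\<forall>\<^sub>F t in at_right 0. q t < e"
      using t by (auto simp: eventually_at_right)
  qed
  then show ?thesis using that unfolding q_def by blast
qed

lemma divide_add_one_mult_le:
  fixes e a :: real
  assumes "0 < e" "0 \<le> a"
  shows "e / (a + 1) * a \<le> e"
proof -
  have "e * a \<le> e * (a + 1)" using assms by simp
  then show ?thesis using assms by (simp add: pos_divide_le_eq)
qed

text \<open>The one-sided directional derivative of the norm is sublinear, and smoothness makes it odd,
  so it is a norming functional and no Hahn-Banach argument is needed.\<close>

lemma norming_functional_exists:
  fixes x :: "'a::real_normed_vector"
  assumes smooth: "uniformly_smooth TYPE('a)" and x: "norm x = 1"
  obtains f :: "'a \<Rightarrow>\<^sub>L real" where "norm f = 1" "blinfun_apply f x = 1"
proof -
  define q where "q h t = (norm (x + t *\<^sub>R h) - norm x) / t" for h t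
  have "\<forall>h. \<exists>d. (q h \<longlongrightarrow> d) (at_right 0)"
    unfolding q_def using norm_slope_tendsto by blast
  then obtain d where d: "\<And>h. (q h \<longlongrightarrow> d h) (at_right 0)"
    by metis
  have pos: "\<forall>\<^sub>F t::real in at_right 0. t > 0"
    by (simp add: eventually_at_filter)
  \<comment> \<open>Rescaling the step keeps the limit: general \<open>c\<close> serves homogeneity,
    \<open>c = 2\<close> subadditivity.\<close>
  have dc: "((\<lambda>t. q h (c * t)) \<longlongrightarrow> d h) (at_right 0)" if "c > 0" for c h
    using d[of h] by (rule filterlim_compose)
      (rule filterlim_times_pos[OF filterlim_ident that], simp)
  have bound: "\<bar>d h\<bar> \<le> norm h" for h
    by (rule tendsto_upperbound[OF tendsto_rabs[OF d]], rule eventually_mono[OF pos])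
      (use norm_slope_abs_le[of _ x h] in \<open>auto simp: q_def\<close>)
  have scale_pos: "d (c *\<^sub>R h) = c * d h" if "c > 0" for c h
  proof (rule tendsto_unique[OF _ d])
    show "(q (c *\<^sub>R h) \<longlongrightarrow> c * d h) (at_right 0)"
      by (rule Lim_transform_eventually[OF tendsto_mult_left[OF dc[OF that]]], rule eventually_mono[OF pos])
        (use that in \<open>auto simp: q_def ac_simps\<close>)
  qed simp
  have subadd: "d (h + k) \<le> d h + d k" for h k
  proof (rule tendsto_le[OF _ tendsto_add[OF dc dc] d])
    \<comment> \<open>\<open>x + t *\<^sub>R (h + k)\<close> is the midpoint of
      \<open>x + (2 * t) *\<^sub>R h\<close> and \<open>x + (2 * t) *\<^sub>R k\<close>, hence the
      doubled step on the right.\<close>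
    have "q (h + k) t \<le> q h (2 * t) + q k (2 * t)" if "t > 0" for t
    proof -
      have "2 *\<^sub>R (x + t *\<^sub>R (h + k)) = (x + (2 * t) *\<^sub>R h) + (x + (2 * t) *\<^sub>R k)"
        by (simp add: algebra_simps scaleR_2)
      then have "2 * norm (x + t *\<^sub>R (h + k)) \<le> norm (x + (2 * t) *\<^sub>R h) + norm (x + (2 * t) *\<^sub>R k)"
        by (metis norm_scaleR norm_triangle_ineq abs_numeral)
      then have "0 \<le> (norm (x + (2 * t) *\<^sub>R h) + norm (x + (2 * t) *\<^sub>R k)
          - 2 * norm (x + t *\<^sub>R (h + k))) / (2 * t)"
        using that by (intro divide_nonneg_pos) auto
      also have "\<dots> = q h (2 * t) + q k (2 * t) - q (h + k) t"
        using that unfolding q_def by (simp add: divide_simps)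
      finally show ?thesis by simp
    qed
    then show "\<forall>\<^sub>F t in at_right 0. q (h + k) t \<le> q h (2 * t) + q k (2 * t)"
      by (intro eventually_mono[OF pos]) auto
  qed auto
  have d0: "d 0 = 0"
    using bound[of 0] by simp
  have odd: "d (- h) = - d h" for h
  proof -
    have "d h + d (- h) \<le> 0"
    proof (rule field_le_epsilon)
      fix e :: real assume "e > 0"
      define \<epsilon> where "\<epsilon> = e / (norm h + 1)"
      have "\<epsilon> > 0" unfolding \<epsilon>_def using \<open>e > 0\<close> by (simp add: add_nonneg_pos)
      then obtain \<delta> where \<delta>: "\<delta> > 0"
        "\<And>y::'a. norm y \<le> \<delta> \<Longrightarrow> norm (x + y) + norm (x - y) \<le> 2 + \<epsilon> * norm y"
        using smooth x unfolding uniformly_smooth_def by blast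
      \<comment> \<open>For \<open>t < r\<close> the vector \<open>t *\<^sub>R h\<close> has norm at
        most \<delta>, so smoothness bounds the sum of the two opposite slopes. The summand 1 covers
        \<open>h = 0\<close>.\<close>
      define r where "r = \<delta> / (norm h + 1)"
      have "r > 0" unfolding r_def using \<delta> by (simp add: add_nonneg_pos)
      have "q h t + q (- h) t \<le> \<epsilon> * norm h" if "0 < t" "t < r" for t
      proof -
        have "t * norm h \<le> r * (norm h + 1)"
          using that by (intro mult_mono) auto
        also have "\<dots> = \<delta>"
          unfolding r_def using norm_ge_zero[of h] by (simp add: add_nonneg_eq_0_iff)
        finally have "norm (x + t *\<^sub>R h) + norm (x - t *\<^sub>R h) \<le> 2 + \<epsilon> * (t * norm h)"
          using \<delta>(2)[of "t *\<^sub>R h"] that by simp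
        then have "norm (x + t *\<^sub>R h) + norm (x - t *\<^sub>R h) - 2 \<le> \<epsilon> * norm h * t"
          by (simp add: algebra_simps)
        moreover have "q h t + q (- h) t = (norm (x + t *\<^sub>R h) + norm (x - t *\<^sub>R h) - 2) / t"
          using x unfolding q_def by (simp add: add_divide_distrib diff_divide_distrib)
        ultimately show ?thesis
          using that by (simp add: pos_divide_le_eq)
      qed
      then have "\<forall>\<^sub>F t in at_right 0. q h t + q (- h) t \<le> \<epsilon> * norm h"
        unfolding eventually_at_right_field using \<open>r > 0\<close> by blast
      then have "d h + d (- h) \<le> \<epsilon> * norm h"
        by (intro tendsto_upperbound[OF tendsto_add[OF d d]]) auto
      also have "\<dots> \<le> 0 + e"
        unfolding \<epsilon>_def using \<open>e > 0\<close> divide_add_one_mult_le[of e "norm h"] by simp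
      finally show "d h + d (- h) \<le> 0 + e" .
    qed
    moreover have "0 \<le> d h + d (- h)"
      using subadd[of h "- h"] d0 by simp
    ultimately show ?thesis by simp
  qed
  \<comment> \<open>The reverse inequality is subadditivity for the pair \<open>h + k\<close>,
    \<open>- k\<close>, combined with oddness.\<close>
  have add: "d (h + k) = d h + d k" for h k
    using subadd[of h k] subadd[of "h + k" "- k"] odd[of k] by simp
  have scale: "d (c *\<^sub>R h) = c * d h" for c h
    using scale_pos[of c h] scale_pos[of "- c" h] odd[of "c *\<^sub>R h"] d0
    by (cases c "0::real" rule: linorder_cases) auto
  have "bounded_linear d"
    using bound by (intro bounded_linear_intro[of d 1]) (auto simp: add scale)
  then have f: "blinfun_apply (Blinfun d) = d"
    by (rule bounded_linear_Blinfun_apply)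
  have "d x = 1"
  proof (rule tendsto_unique[OF _ d])
    have "q x t = 1" if "t > 0" for t
    proof -
      have "x + t *\<^sub>R x = (1 + t) *\<^sub>R x" by (simp add: algebra_simps)
      then show ?thesis using that x unfolding q_def by simp
    qed
    then show "(q x \<longlongrightarrow> 1) (at_right 0)"
      by (intro tendsto_eventually eventually_mono[OF pos]) auto
  qed simp
  moreover have "norm (Blinfun d) = 1"
  proof (rule antisym)
    show "norm (Blinfun d) \<le> 1"
      using bound by (intro norm_blinfun_bound) (auto simp: f)
    show "1 \<le> norm (Blinfun d)"
      using norm_blinfun[of "Blinfun d" x] x \<open>d x = 1\<close> by (simp add: f)
  qed
  ultimately show ?thesis
    using that[of "Blinfun d"] f by simp
qed

lemma duality_pair_exists:
  fixes x :: "'a::real_normed_vector"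
  assumes "uniformly_smooth TYPE('a)"
  obtains f where "duality_pair x f"
proof (cases "x = 0")
  case True
  then show ?thesis using that[of 0] by (simp add: duality_pair_def)
next
  case False
  then obtain f :: "'a \<Rightarrow>\<^sub>L real" where "norm f = 1" "f ((1 / norm x) *\<^sub>R x) = 1"
    using norming_functional_exists[OF assms, of "(1 / norm x) *\<^sub>R x"] by auto
  then have "f x = norm x"
    using False by (simp add: blinfun.scaleR_right)
  then show ?thesis
    using that[of "norm x *\<^sub>R f"] \<open>norm f = 1\<close>
    by (simp add: duality_pair_def blinfun.scaleR_left)
qed

text \<open>Test with \<open>k\<close> parallel to \<open>h\<close> and of norm \<delta>. Adding
  \<open>f (x + k) \<le> norm (x + k)\<close> and \<open>g (x - k) \<le> norm (x - k)\<close> bounds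
  \<open>(f - g) k\<close>, up to the error \<open>g (y - x)\<close> from \<open>g\<close> norming
  \<open>y\<close> instead of \<open>x\<close>.\<close>

lemma norming_functionals_close:
  fixes x y :: "'a::real_normed_vector" and f g :: "'a \<Rightarrow>\<^sub>L real"
  assumes \<delta>: "\<delta> > 0" "\<And>h::'a. norm h \<le> \<delta> \<Longrightarrow> norm (x + h) + norm (x - h) \<le> 2 + \<epsilon> * norm h"
    and f: "norm f = 1" "f x = 1" and g: "norm g = 1" "g y = 1" and "\<epsilon> > 0"
  shows "norm (f - g) \<le> \<epsilon> + norm (x - y) / \<delta>"
proof (rule norm_blinfun_bound)
  show "0 \<le> \<epsilon> + norm (x - y) / \<delta>"
    using assms by simp
  fix h :: 'a
  have main: "(f - g) h \<le> (\<epsilon> + norm (x - y) / \<delta>) * norm h" for h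
  proof (cases "h = 0")
    case False
    define k where "k = (\<delta> / norm h) *\<^sub>R h"
    have k: "norm k = \<delta>" using False \<delta> by (simp add: k_def)
    have "f (x + k) \<le> norm (x + k)" "g (x - k) \<le> norm (x - k)" "g (y - x) \<le> norm (y - x)"
      using norm_blinfun[of f "x + k"] norm_blinfun[of g "x - k"] norm_blinfun[of g "y - x"] f g
      by auto
    then have "(f - g) k \<le> \<epsilon> * \<delta> + norm (x - y)"
      using \<delta>(2)[of k] k f g
      by (simp add: blinfun.add_right blinfun.diff_right blinfun.diff_left norm_minus_commute)
    moreover have "(f - g) h = (norm h / \<delta>) * (f - g) k"
      using False \<delta> by (simp add: k_def blinfun.scaleR_right)
    ultimately have "(f - g) h \<le> (norm h / \<delta>) * (\<epsilon> * \<delta> + norm (x - y))"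
      using \<delta> by (simp add: divide_right_mono mult_left_mono)
    then show ?thesis using \<delta> by (simp add: field_simps)
  qed simp
  show "norm ((f - g) h) \<le> (\<epsilon> + norm (x - y) / \<delta>) * norm h"
    using main[of h] main[of "- h"] by (simp add: blinfun.minus_right abs_le_iff)
qed

text \<open>\<open>K\<close> depends on \<epsilon> alone. Thus one estimate yields uniqueness of the
  dual functional (\<open>y = x\<close>) and uniform continuity of the duality mapping on bounded
  sets.\<close>

lemma duality_pair_close:
  assumes "uniformly_smooth TYPE('a::real_normed_vector)" "\<epsilon> > 0"
  obtains K where "K \<ge> 0"
    "\<And>(x::'a) y f g. duality_pair x f \<Longrightarrow> duality_pair y g \<Longrightarrow>
      norm (f - g) \<le> \<epsilon> * norm x + K * norm (x - y)"
proof -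
  obtain \<delta> where \<delta>: "\<delta> > 0" "\<And>x h::'a. norm x = 1 \<Longrightarrow> norm h \<le> \<delta> \<Longrightarrow>
      norm (x + h) + norm (x - h) \<le> 2 + \<epsilon> * norm h"
    using assms unfolding uniformly_smooth_def by blast
  have K: "norm (f - g) \<le> \<epsilon> * norm x + (2 / \<delta> + 1) * norm (x - y)"
    if fg: "duality_pair x f" "duality_pair y g" for x y :: 'a and f g
  proof -
    have 1: "norm (x - y) \<le> (2 / \<delta> + 1) * norm (x - y)"
      using \<delta>(1) by (simp add: algebra_simps)
    consider "x = 0" | "y = 0" | "x \<noteq> 0" "y \<noteq> 0" by blast
    then show ?thesis
    proof cases
      case 1
      then have "norm (f - g) \<le> norm (x - y)"
        using fg by (auto simp: duality_pair_def)
      with \<open>norm (x - y) \<le> _\<close> 1 show ?thesis by simp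
    next
      case 2
      then have "norm (f - g) \<le> norm (x - y)"
        using fg by (auto simp: duality_pair_def)
      moreover have "0 \<le> \<epsilon> * norm x" using assms by simp
      ultimately show ?thesis using \<open>norm (x - y) \<le> _\<close> by linarith
    next
      case 3
      \<comment> \<open>Normalise to unit vectors, then multiply back by \<open>norm x\<close>.
        Normalising the points costs \<open>2 * norm (x - y)\<close>, divided by \<delta>;
        normalising the functionals costs one more \<open>norm (x - y)\<close>. This is the constant
        \<open>2 / \<delta> + 1\<close>.\<close>
      define x' y' f' g' where "x' = (1 / norm x) *\<^sub>R x" and "y' = (1 / norm y) *\<^sub>R y"
        and "f' = (1 / norm x) *\<^sub>R f" and "g' = (1 / norm y) *\<^sub>R g"
      have unit: "norm x' = 1" "norm f' = 1" "f' x' = 1" "norm g' = 1" "g' y' = 1"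
        using 3 fg unfolding x'_def y'_def f'_def g'_def
        by (auto simp: duality_pair_def blinfun.scaleR_left blinfun.scaleR_right)
      then have close: "norm (f' - g') \<le> \<epsilon> + norm (x' - y') / \<delta>"
        using \<delta> assms(2) by (intro norming_functionals_close) auto
      have "norm x *\<^sub>R (x' - y') = (x - y) + (norm y - norm x) *\<^sub>R y'"
        using 3 by (simp add: x'_def y'_def algebra_simps)
      then have "norm x * norm (x' - y') \<le> norm (x - y) + norm ((norm y - norm x) *\<^sub>R y')"
        by (metis norm_scaleR norm_triangle_ineq abs_norm_cancel)
      also have "norm ((norm y - norm x) *\<^sub>R y') \<le> norm (x - y)"
        using 3 norm_triangle_ineq3[of x y] by (simp add: y'_def abs_minus_commute)
      finally have xy: "norm x * norm (x' - y') \<le> 2 * norm (x - y)" by simp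
      have "f - g = norm x *\<^sub>R (f' - g') + (norm x - norm y) *\<^sub>R g'"
        using 3 by (simp add: f'_def g'_def algebra_simps)
      then have "norm (f - g) \<le> norm x * norm (f' - g') + norm ((norm x - norm y) *\<^sub>R g')"
        by (metis norm_scaleR norm_triangle_ineq abs_norm_cancel)
      also have "norm ((norm x - norm y) *\<^sub>R g') \<le> norm (x - y)"
        using unit norm_triangle_ineq3[of x y] by simp
      also have "norm x * norm (f' - g') \<le> norm x * (\<epsilon> + norm (x' - y') / \<delta>)"
        using close by (rule mult_left_mono) simp
      also have "\<dots> = \<epsilon> * norm x + norm x * norm (x' - y') / \<delta>"
        by (simp add: algebra_simps)
      also have "norm x * norm (x' - y') / \<delta> \<le> 2 * norm (x - y) / \<delta>"
        using xy \<delta> by (intro divide_right_mono) auto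
      finally show ?thesis by (simp add: algebra_simps)
    qed
  qed
  show ?thesis
    using that[of "2 / \<delta> + 1"] K \<delta> by simp
qed

text \<open>At \<open>y = x\<close> the closeness estimate leaves only
  \<open>\<epsilon> * norm x\<close>, which is arbitrarily small.\<close>

lemma duality_pair_unique:
  fixes x :: "'a::real_normed_vector"
  assumes "uniformly_smooth TYPE('a)" "duality_pair x f" "duality_pair x g"
  shows "f = g"
proof -
  have "norm (f - g) \<le> 0"
  proof (rule field_le_epsilon)
    fix e :: real assume "e > 0"
    define \<epsilon> where "\<epsilon> = e / (norm x + 1)"
    have "\<epsilon> > 0" unfolding \<epsilon>_def using \<open>e > 0\<close> by (simp add: add_nonneg_pos)
    then obtain K where "norm (f - g) \<le> \<epsilon> * norm x + K * norm (x - x)"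
      using duality_pair_close[OF assms(1)] assms(2,3) by meson
    also have "\<dots> \<le> 0 + e"
      unfolding \<epsilon>_def using \<open>e > 0\<close> divide_add_one_mult_le[of e "norm x"] by simp
    finally show "norm (f - g) \<le> 0 + e" .
  qed
  then show ?thesis by simp
qed

lemma duality_pair_duality_map:
  fixes x :: "'a::real_normed_vector"
  assumes "uniformly_smooth TYPE('a)"
  shows "duality_pair x (duality_map x)"
proof -
  have "\<exists>!f. duality_pair x f"
    using duality_pair_exists[OF assms] duality_pair_unique[OF assms] by metis
  then show ?thesis
    unfolding duality_map_def duality_pair_def by (rule theI')
qed

lemma norm_duality_map:
  fixes x :: "'a::real_normed_vector"
  assumes "uniformly_smooth TYPE('a)"
  shows "norm (duality_map x) = norm x"
  using duality_pair_duality_map[OF assms, of x] by (simp add: duality_pair_def)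

lemma duality_map_self:
  fixes x :: "'a::real_normed_vector"
  assumes "uniformly_smooth TYPE('a)"
  shows "blinfun_apply (duality_map x) x = (norm x)\<^sup>2"
  using duality_pair_duality_map[OF assms, of x] by (simp add: duality_pair_def power2_eq_square)

lemma duality_map_le:
  fixes x y :: "'a::real_normed_vector"
  assumes "uniformly_smooth TYPE('a)"
  shows "blinfun_apply (duality_map y) x \<le> norm x * norm y"
  using norm_blinfun[of "duality_map y" x] norm_duality_map[OF assms, of y]
  by (simp add: mult.commute)

text \<open>\<open>duality_pair_close\<close> involves the norm of its first point only, so a bound
  on \<open>X\<close> suffices. \<epsilon> is chosen to keep that term below \<open>e / 2\<close>,
  and the other term vanishes in the limit.\<close>

lemma duality_map_diff_tendsto:
  fixes X Y :: "'b \<Rightarrow> 'a::real_normed_vector"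
  assumes "uniformly_smooth TYPE('a)"
    and bounded: "\<forall>\<^sub>F n in F. norm (X n) \<le> R"
    and lim: "((\<lambda>n. norm (X n - Y n)) \<longlongrightarrow> 0) F"
  shows "((\<lambda>n. norm (duality_map (X n) - duality_map (Y n))) \<longlongrightarrow> 0) F"
proof (rule order_tendstoI)
  fix e :: real assume "e > 0"
  define \<epsilon> where "\<epsilon> = e / (2 * (\<bar>R\<bar> + 1))"
  have "\<epsilon> > 0" using \<open>e > 0\<close> by (simp add: \<epsilon>_def add_nonneg_pos)
  then obtain K where K: "K \<ge> 0" "\<And>n. norm (duality_map (X n) - duality_map (Y n))
      \<le> \<epsilon> * norm (X n) + K * norm (X n - Y n)"
    using duality_pair_close[OF assms(1)] duality_pair_duality_map[OF assms(1)] by metis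
  have R: "\<epsilon> * norm (X n) \<le> e / 2" if "norm (X n) \<le> R" for n
  proof -
    have "\<epsilon> * norm (X n) \<le> \<epsilon> * (\<bar>R\<bar> + 1)"
      using that \<open>\<epsilon> > 0\<close> by (intro mult_left_mono) auto
    also have "\<dots> = e / 2" by (simp add: \<epsilon>_def divide_simps add_nonneg_eq_0_iff)
    finally show ?thesis .
  qed
  have "((\<lambda>n. K * norm (X n - Y n)) \<longlongrightarrow> 0) F"
    using tendsto_mult_left[OF lim, of K] by simp
  then have "\<forall>\<^sub>F n in F. K * norm (X n - Y n) < e / 2"
    by (rule order_tendstoD) (use \<open>e > 0\<close> in simp)
  with bounded show "\<forall>\<^sub>F n in F. norm (duality_map (X n) - duality_map (Y n)) < e"
  proof eventually_elim
    case (elim n)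
    then show ?case
      using K(2)[of n] R[of n] by linarith
  qed
qed (simp add: order_less_le_trans)

section \<open>Uniform convexity and the Lyapunov functional\<close>

text \<open>Either the norms differ by at least \<open>\<epsilon> / 4\<close>, and strict convexity
  of the real square gives the gain, or they nearly agree, and the directions must differ enough for
  uniform convexity on the unit sphere.\<close>

lemma uniformly_convex_norm_sq_ordered:
  fixes x y :: "'a::real_normed_vector"
  assumes \<delta>: "\<And>u v::'a. norm u = 1 \<Longrightarrow> norm v = 1 \<Longrightarrow> norm (u - v) \<ge> \<epsilon> / (2 * R) \<Longrightarrow>
      norm ((1/2) *\<^sub>R (u + v)) \<le> 1 - \<delta>"
    and "\<delta> > 0" "\<epsilon> > 0" "norm x \<le> R" "norm y \<le> norm x" "norm (x - y) \<ge> \<epsilon>"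
  shows "(norm ((1/2) *\<^sub>R (x + y)))\<^sup>2
    \<le> ((norm x)\<^sup>2 + (norm y)\<^sup>2) / 2 - (min (\<epsilon> / 8) (\<epsilon> * \<delta> / 4))\<^sup>2"
proof -
  define s t m where "s = norm x" and "t = norm y" and "m = norm ((1/2) *\<^sub>R (x + y))"
  have m: "0 \<le> m" "m \<le> (s + t) / 2"
    using norm_triangle_ineq[of x y] by (simp_all add: m_def s_def t_def)
  have avg: "((s + t) / 2)\<^sup>2 = (s\<^sup>2 + t\<^sup>2) / 2 - ((s - t) / 2)\<^sup>2"
    by (simp add: power2_eq_square field_simps)
  have "m\<^sup>2 \<le> (s\<^sup>2 + t\<^sup>2) / 2 - (min (\<epsilon> / 8) (\<epsilon> * \<delta> / 4))\<^sup>2"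
  proof (cases "s - t \<ge> \<epsilon> / 4")
    case True
    have "m\<^sup>2 \<le> ((s + t) / 2)\<^sup>2"
      using m by (rule power_mono[rotated])
    moreover have "(min (\<epsilon> / 8) (\<epsilon> * \<delta> / 4))\<^sup>2 \<le> ((s - t) / 2)\<^sup>2"
      using True assms by (intro power_mono) auto
    ultimately show ?thesis using avg by linarith
  next
    case False
    \<comment> \<open>A lower bound on \<open>t\<close> is needed because the gain below is
      \<open>t * \<delta>\<close>.\<close>
    have "s + t \<ge> \<epsilon>"
      using norm_triangle_ineq4[of x y] assms(6) by (simp add: s_def t_def)
    then have t: "t \<ge> \<epsilon> / 4" "t > 0" "s > 0" "t \<le> s" "s \<le> R"
      using False \<open>\<epsilon> > 0\<close> \<open>norm x \<le> R\<close> \<open>norm y \<le> norm x\<close> unfolding s_def t_def by linarith+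
    \<comment> \<open>\<open>x\<close> is shrunk to the norm of \<open>y\<close>. This moves it by
      less than \<open>\<epsilon> / 4\<close>, so it stays at least \<open>\<epsilon> / 2\<close>
      away from \<open>y\<close>.\<close>
    define x' where "x' = (t / s) *\<^sub>R x"
    have "x - x' = (1 - t / s) *\<^sub>R x" by (simp add: x'_def algebra_simps)
    then have "norm (x - x') = \<bar>1 - t / s\<bar> * s" by (simp add: s_def)
    also have "\<dots> = s - t" using t by (simp add: left_diff_distrib)
    finally have xx': "norm (x - x') = s - t" .
    have "norm (x' - y) \<ge> \<epsilon> / 2"
      using norm_triangle_ineq[of "x - x'" "x' - y"] xx' False assms by simp
    moreover have "norm (x' - y) = t * norm ((1/t) *\<^sub>R x' - (1/t) *\<^sub>R y)"
      using t by (simp flip: scaleR_diff_right)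
    ultimately have "\<epsilon> / 2 \<le> t * norm ((1/t) *\<^sub>R x' - (1/t) *\<^sub>R y)" by simp
    also have "\<dots> \<le> R * norm ((1/t) *\<^sub>R x' - (1/t) *\<^sub>R y)"
      using t by (intro mult_right_mono) auto
    finally have "norm ((1/t) *\<^sub>R x' - (1/t) *\<^sub>R y) \<ge> \<epsilon> / (2 * R)"
      using t by (simp add: field_simps)
    moreover have "norm x' = t" "norm y = t"
      using t by (auto simp: x'_def s_def t_def)
    ultimately have "norm ((1/2) *\<^sub>R ((1/t) *\<^sub>R x' + (1/t) *\<^sub>R y)) \<le> 1 - \<delta>"
      using t by (intro \<delta>) auto
    moreover define w where "w = (1/2) *\<^sub>R (x' + y)"
    have "(1/2) *\<^sub>R ((1/t) *\<^sub>R x' + (1/t) *\<^sub>R y) = (1/t) *\<^sub>R w"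
      by (simp add: w_def algebra_simps)
    ultimately have "norm ((1/t) *\<^sub>R w) \<le> 1 - \<delta>"
      by (simp only:)
    then have "norm w \<le> t * (1 - \<delta>)"
      using t by (simp add: field_simps)
    moreover have "m \<le> norm w + norm ((1/2) *\<^sub>R (x - x'))"
      using norm_triangle_ineq[of "(1/2) *\<^sub>R (x' + y)" "(1/2) *\<^sub>R (x - x')"]
      by (simp add: m_def w_def algebra_simps)
    moreover have "norm ((1/2) *\<^sub>R (x - x')) = (s - t) / 2"
      unfolding norm_scaleR xx' by simp
    ultimately have "m \<le> (s + t) / 2 - t * \<delta>"
      by (simp add: field_simps)
    moreover define c where "c = min (\<epsilon> / 8) (\<epsilon> * \<delta> / 4)"
    have c: "0 \<le> c" "c \<le> \<epsilon> / 4 * \<delta>" using assms by (auto simp: c_def)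
    moreover have "\<epsilon> / 4 * \<delta> \<le> t * \<delta>"
      using t assms by (intro mult_right_mono) auto
    ultimately have mc: "m + c \<le> (s + t) / 2" by linarith
    have "m\<^sup>2 + c\<^sup>2 \<le> (m + c)\<^sup>2"
      using c m by (simp add: power2_sum)
    also have "\<dots> \<le> ((s + t) / 2)\<^sup>2"
      using mc m c by (intro power_mono) auto
    finally show ?thesis using avg zero_le_power2[of "(s - t) / 2"] unfolding c_def by linarith
  qed
  then show ?thesis by (simp add: s_def t_def m_def)
qed

lemma uniformly_convex_norm_sq:
  assumes "uniformly_convex TYPE('a::real_normed_vector)" "\<epsilon> > 0"
  obtains \<delta> where "\<delta> > 0"
    "\<And>x y::'a. norm x \<le> R \<Longrightarrow> norm y \<le> R \<Longrightarrow> norm (x - y) \<ge> \<epsilon> \<Longrightarrow>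
      (norm ((1/2) *\<^sub>R (x + y)))\<^sup>2 \<le> ((norm x)\<^sup>2 + (norm y)\<^sup>2) / 2 - \<delta>"
proof -
  \<comment> \<open>The maximum with 1 makes the radius in the denominator positive.\<close>
  define S where "S = max R 1"
  have "\<epsilon> / (2 * S) > 0" using assms(2) by (simp add: S_def)
  then obtain \<delta> where \<delta>: "\<delta> > 0"
    "\<And>u v::'a. norm u = 1 \<Longrightarrow> norm v = 1 \<Longrightarrow> norm (u - v) \<ge> \<epsilon> / (2 * S) \<Longrightarrow>
      norm ((1/2) *\<^sub>R (u + v)) \<le> 1 - \<delta>"
    using assms(1) unfolding uniformly_convex_def by blast
  show ?thesis
  proof (rule that)
    show "(min (\<epsilon> / 8) (\<epsilon> * \<delta> / 4))\<^sup>2 > 0"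
      using \<delta> assms(2) by (simp add: min_def)
    fix x y :: 'a
    assume *: "norm x \<le> R" "norm y \<le> R" "norm (x - y) \<ge> \<epsilon>"
    have S: "norm x \<le> S" "norm y \<le> S" using * by (auto simp: S_def)
    have ord: "(norm ((1/2) *\<^sub>R (u + v)))\<^sup>2
        \<le> ((norm u)\<^sup>2 + (norm v)\<^sup>2) / 2 - (min (\<epsilon> / 8) (\<epsilon> * \<delta> / 4))\<^sup>2"
      if "norm u \<le> S" "norm v \<le> norm u" "norm (u - v) \<ge> \<epsilon>" for u v :: 'a
      using \<delta>(2,1) assms(2) that by (rule uniformly_convex_norm_sq_ordered[where R = S])
    show "(norm ((1/2) *\<^sub>R (x + y)))\<^sup>2
        \<le> ((norm x)\<^sup>2 + (norm y)\<^sup>2) / 2 - (min (\<epsilon> / 8) (\<epsilon> * \<delta> / 4))\<^sup>2"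
    proof (cases "norm y \<le> norm x")
      case True
      then show ?thesis using S(1) *(3) by (intro ord)
    next
      case False
      then have "norm x \<le> norm y" "norm (y - x) \<ge> \<epsilon>"
        using *(3) by (simp_all add: norm_minus_commute)
      from ord[OF S(2) this] show ?thesis
        by (simp only: add.commute[of y x] add.commute[of "(norm y)\<^sup>2"])
    qed
  qed
qed

text \<open>Serves to bound norms: a bound on \<open>lyapunov x y\<close> and on one of the two
  norms bounds the other.\<close>

lemma lyapunov_ge_norm_diff_sq:
  fixes x y :: "'a::real_normed_vector"
  assumes "uniformly_smooth TYPE('a)"
  shows "(norm x - norm y)\<^sup>2 \<le> lyapunov x y"
  using duality_map_le[OF assms, of y x] by (simp add: lyapunov_def power2_diff)

lemma lyapunov_nonneg:
  fixes x y :: "'a::real_normed_vector"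
  assumes "uniformly_smooth TYPE('a)"
  shows "0 \<le> lyapunov x y"
  using lyapunov_ge_norm_diff_sq[OF assms, of x y] zero_le_power2[of "norm x - norm y"] by linarith

lemma lyapunov_self:
  fixes x :: "'a::real_normed_vector"
  assumes "uniformly_smooth TYPE('a)"
  shows "lyapunov x x = 0"
  by (simp add: lyapunov_def duality_map_self[OF assms])

text \<open>The pairing on the right is the one in the resolvent and projection inequalities; once
  it is nonnegative, \<open>lyapunov p z + lyapunov z x \<le> lyapunov p x\<close>.\<close>

lemma lyapunov_three_point:
  fixes p x z :: "'a::real_normed_vector"
  assumes "uniformly_smooth TYPE('a)"
  shows "lyapunov p z + lyapunov z x
    = lyapunov p x - 2 * blinfun_apply (duality_map z - duality_map x) (p - z)"
  using duality_map_self[OF assms, of z]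
  by (simp add: lyapunov_def blinfun.diff_left blinfun.diff_right)

text \<open>Evaluating \<open>duality_map y\<close> at the midpoint bounds
  \<open>duality_map y x\<close> by the squared norm of the midpoint. If \<open>x\<close> and
  \<open>y\<close> were \<epsilon> apart, uniform convexity would then force
  \<open>lyapunov x y \<ge> 2 * \<delta>\<close>.\<close>

lemma lyapunov_small:
  assumes smooth: "uniformly_smooth TYPE('a::real_normed_vector)"
    and convex: "uniformly_convex TYPE('a)" and "\<epsilon> > 0"
  obtains \<delta> where "\<delta> > 0"
    "\<And>x y::'a. norm x \<le> R \<or> norm y \<le> R \<Longrightarrow> lyapunov x y < \<delta> \<Longrightarrow> norm (x - y) < \<epsilon>"
proof -
  obtain \<delta> where \<delta>: "\<delta> > 0" "\<And>x y::'a. norm x \<le> R + 1 \<Longrightarrow> norm y \<le> R + 1 \<Longrightarrow> norm (x - y) \<ge> \<epsilon> \<Longrightarrow>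
      (norm ((1/2) *\<^sub>R (x + y)))\<^sup>2 \<le> ((norm x)\<^sup>2 + (norm y)\<^sup>2) / 2 - \<delta>"
    using uniformly_convex_norm_sq[OF convex \<open>\<epsilon> > 0\<close>, of "R + 1"] by blast
  show ?thesis
  \<comment> \<open>The bound 1 keeps the two norms within 1 of each other, so both are at most
    \<open>R + 1\<close>.\<close>
  proof (rule that[of "min 1 (2 * \<delta>)"])
    show "0 < min 1 (2 * \<delta>)" using \<delta> by simp
    fix x y :: 'a
    assume xy: "norm x \<le> R \<or> norm y \<le> R" "lyapunov x y < min 1 (2 * \<delta>)"
    have "(norm x - norm y)\<^sup>2 < 1"
      using lyapunov_ge_norm_diff_sq[OF smooth, of x y] xy(2) by linarith
    then have "\<bar>norm x - norm y\<bar> < 1" by (simp add: abs_square_less_1)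
    then have R: "norm x \<le> R + 1" "norm y \<le> R + 1" using xy(1) by auto
    show "norm (x - y) < \<epsilon>"
    proof (rule ccontr)
      assume "\<not> norm (x - y) < \<epsilon>"
      then have mid: "(norm ((1/2) *\<^sub>R (x + y)))\<^sup>2 \<le> ((norm x)\<^sup>2 + (norm y)\<^sup>2) / 2 - \<delta>"
        using \<delta>(2) R by simp
      have "duality_map y ((1/2) *\<^sub>R (x + y)) \<le> norm ((1/2) *\<^sub>R (x + y)) * norm y"
        by (rule duality_map_le[OF smooth])
      also have "\<dots> \<le> ((norm ((1/2) *\<^sub>R (x + y)))\<^sup>2 + (norm y)\<^sup>2) / 2"
        using sum_squares_bound[of "norm ((1/2) *\<^sub>R (x + y))" "norm y"] by simp
      finally have "2 * (duality_map y x + (norm y)\<^sup>2) \<le> 2 * (norm ((1/2) *\<^sub>R (x + y)))\<^sup>2 + 2 * (norm y)\<^sup>2"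
        by (simp add: blinfun.scaleR_right blinfun.add_right duality_map_self[OF smooth])
      moreover have "lyapunov x y < 2 * \<delta>" using xy(2) by simp
      ultimately show False
        using mid unfolding lyapunov_def by argo
    qed
  qed
qed

lemma lyapunov_tendsto_zero_imp:
  fixes X Y :: "'b \<Rightarrow> 'a::real_normed_vector"
  assumes smooth: "uniformly_smooth TYPE('a)" and convex: "uniformly_convex TYPE('a)"
    and bounded: "\<forall>\<^sub>F n in F. norm (X n) \<le> R \<or> norm (Y n) \<le> R"
    and lim: "((\<lambda>n. lyapunov (X n) (Y n)) \<longlongrightarrow> 0) F"
  shows "((\<lambda>n. norm (X n - Y n)) \<longlongrightarrow> 0) F"
proof (rule order_tendstoI)
  fix e :: real assume "e > 0"
  then obtain \<delta> where \<delta>: "\<delta> > 0"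
    "\<And>x y::'a. norm x \<le> R \<or> norm y \<le> R \<Longrightarrow> lyapunov x y < \<delta> \<Longrightarrow> norm (x - y) < e"
    using lyapunov_small[OF smooth convex] by blast
  have "\<forall>\<^sub>F n in F. lyapunov (X n) (Y n) < \<delta>"
    using lim \<delta>(1) by (rule order_tendstoD)
  with bounded show "\<forall>\<^sub>F n in F. norm (X n - Y n) < e"
    by eventually_elim (rule \<delta>(2))
qed (simp add: order_less_le_trans)

lemma lyapunov_eq_zero_imp_eq:
  fixes x y :: "'a::real_normed_vector"
  assumes "uniformly_smooth TYPE('a)" "uniformly_convex TYPE('a)" "lyapunov x y \<le> 0"
  shows "x = y"
proof -
  have "lyapunov x y = 0"
    using assms(3) lyapunov_nonneg[OF assms(1), of x y] by simp
  then have "((\<lambda>n::nat. norm (x - y)) \<longlongrightarrow> 0) sequentially"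
    by (intro lyapunov_tendsto_zero_imp[OF assms(1,2), where R = "norm x"]) auto
  then show ?thesis by (simp add: LIMSEQ_const_iff)
qed

text \<open>The squared norms differ by a multiple of the distance, and the pairings by the distance
  of the dual images; both vanish in the limit.\<close>

lemma lyapunov_diff_tendsto:
  fixes X Y :: "'b \<Rightarrow> 'a::real_normed_vector"
  assumes smooth: "uniformly_smooth TYPE('a)"
    and bounded: "\<forall>\<^sub>F n in F. norm (X n) \<le> R"
    and lim: "((\<lambda>n. norm (X n - Y n)) \<longlongrightarrow> 0) F"
  shows "((\<lambda>n. lyapunov p (X n) - lyapunov p (Y n)) \<longlongrightarrow> 0) F"
proof (rule tendsto_rabs_zero_cancel, rule tendsto_sandwich[of "\<lambda>_. 0"])
  let ?d = "\<lambda>n. norm (X n - Y n)" and ?e = "\<lambda>n. norm (duality_map (X n) - duality_map (Y n))"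
  show "\<forall>\<^sub>F n in F. \<bar>lyapunov p (X n) - lyapunov p (Y n)\<bar> \<le> ?d n * (2 * R + ?d n) + 2 * (?e n * norm p)"
    using bounded
  proof eventually_elim
    case (elim n)
    have d: "\<bar>norm (X n) - norm (Y n)\<bar> \<le> ?d n" by (rule norm_triangle_ineq3)
    have "\<bar>(norm (X n))\<^sup>2 - (norm (Y n))\<^sup>2\<bar> = \<bar>norm (X n) - norm (Y n)\<bar> * (norm (X n) + norm (Y n))"
      by (simp add: power2_eq_square square_diff_square_factored abs_mult)
    also have "\<dots> \<le> ?d n * (2 * R + ?d n)"
      using d elim by (intro mult_mono) auto
    finally have "\<bar>(norm (X n))\<^sup>2 - (norm (Y n))\<^sup>2\<bar> \<le> ?d n * (2 * R + ?d n)" .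
    moreover have "\<bar>(duality_map (X n) - duality_map (Y n)) p\<bar> \<le> ?e n * norm p"
      using norm_blinfun[of "duality_map (X n) - duality_map (Y n)" p] by simp
    moreover have "lyapunov p (X n) - lyapunov p (Y n)
        = ((norm (X n))\<^sup>2 - (norm (Y n))\<^sup>2) - 2 * (duality_map (X n) - duality_map (Y n)) p"
      by (simp add: lyapunov_def blinfun.diff_left)
    ultimately show ?case by linarith
  qed
  have "((\<lambda>n. ?d n * (2 * R + ?d n) + 2 * (?e n * norm p)) \<longlongrightarrow> 0 * (2 * R + 0) + 2 * (0 * norm p)) F"
    by (intro tendsto_intros lim duality_map_diff_tendsto[OF smooth bounded])
  then show "((\<lambda>n. ?d n * (2 * R + ?d n) + 2 * (?e n * norm p)) \<longlongrightarrow> 0) F" by simp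
qed auto

section \<open>Minimisers and the generalized projection\<close>

text \<open>Serves both surjectivity of the duality mapping (\<open>D = UNIV\<close>) and the
  generalized projection (\<open>g = duality_map x\<close>). A minimizing sequence is Cauchy, since
  the midpoint of two distant terms would lie below the infimum.\<close>

lemma norm_sq_minimizer_exists:
  fixes D :: "'a::banach set" and g :: "'a \<Rightarrow>\<^sub>L real"
  assumes uc: "uniformly_convex TYPE('a)" and "closed D" "convex D" "D \<noteq> {}"
  obtains p where "p \<in> D" "\<And>v. v \<in> D \<Longrightarrow> (norm p)\<^sup>2 - 2 * g p \<le> (norm v)\<^sup>2 - 2 * g v"
proof -
  define h where "h v = (norm v)\<^sup>2 - 2 * g v" for v
  define m where "m = (INF v\<in>D. h v)"
  have lower: "(norm v - norm g)\<^sup>2 - (norm g)\<^sup>2 \<le> h v" for v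
    using norm_blinfun[of g v] by (simp add: h_def power2_diff mult.commute)
  have "- (norm g)\<^sup>2 \<le> h v" for v
    using lower[of v] zero_le_power2[of "norm v - norm g"] by linarith
  then have bdd: "bdd_below (h ` D)"
    by (rule bdd_belowI2)
  have m_le: "m \<le> h v" if "v \<in> D" for v
    unfolding m_def by (rule cINF_lower[OF bdd that])
  define c where "c = (\<lambda>n. 1 / real (Suc n))"
  have c: "0 < c n" "c n \<le> 1" "c \<longlonglongrightarrow> 0" "n \<le> k \<Longrightarrow> c k \<le> c n" for n k
    using LIMSEQ_Suc[OF lim_1_over_n] unfolding c_def by (auto simp: frac_le)
  have "\<exists>v\<in>D. h v < m + c n" for n
    using cINF_less_iff[OF \<open>D \<noteq> {}\<close> bdd, of "m + c n"] c(1)[of n] by (simp add: m_def)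
  then obtain v where v: "\<And>n. v n \<in> D" "\<And>n. h (v n) < m + c n"
    by metis
  \<comment> \<open>Completing the square in \<open>lower\<close> bounds every term of the
    minimizing sequence by this radius.\<close>
  define R where "R = norm g + sqrt (m + 1 + (norm g)\<^sup>2)"
  have R: "norm (v n) \<le> R" for n
  proof -
    have "(norm (v n) - norm g)\<^sup>2 \<le> m + 1 + (norm g)\<^sup>2"
      using lower[of "v n"] v(2)[of n] c(2)[of n] by linarith
    then have "norm (v n) - norm g \<le> sqrt (m + 1 + (norm g)\<^sup>2)" by (rule real_le_rsqrt)
    then show ?thesis by (simp add: R_def)
  qed
  have "Cauchy v"
  proof (rule CauchyI)
    fix e :: real assume "e > 0"
    then obtain \<delta> where \<delta>: "\<delta> > 0" "\<And>x y::'a. norm x \<le> R \<Longrightarrow> norm y \<le> R \<Longrightarrow> norm (x - y) \<ge> e \<Longrightarrow>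
        (norm ((1/2) *\<^sub>R (x + y)))\<^sup>2 \<le> ((norm x)\<^sup>2 + (norm y)\<^sup>2) / 2 - \<delta>"
      using uniformly_convex_norm_sq[OF uc] by blast
    obtain N where N: "c N < \<delta>"
      using eventually_happens'[OF sequentially_bot order_tendstoD(2)[OF c(3) \<delta>(1)]] by blast
    have "norm (v i - v j) < e" if "i \<ge> N" "j \<ge> N" for i j
    proof (rule ccontr)
      assume "\<not> norm (v i - v j) < e"
      then have "(norm ((1/2) *\<^sub>R (v i + v j)))\<^sup>2 \<le> ((norm (v i))\<^sup>2 + (norm (v j))\<^sup>2) / 2 - \<delta>"
        using \<delta>(2) R by simp
      \<comment> \<open>The linear part of \<open>h\<close> is exact at midpoints, so the gain in
        the squared norm passes to \<open>h\<close> unchanged.\<close>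
      then have "h ((1/2) *\<^sub>R (v i + v j)) \<le> (h (v i) + h (v j)) / 2 - \<delta>"
        by (simp add: h_def blinfun.scaleR_right blinfun.add_right field_simps)
      moreover have "m \<le> h ((1/2) *\<^sub>R (v i + v j))"
        using m_le convexD[OF \<open>convex D\<close> v(1)[of i] v(1)[of j], of "1/2" "1/2"]
        by (simp add: scaleR_add_right)
      moreover have "c i \<le> c N" "c j \<le> c N"
        using that by (simp_all add: c)
      ultimately show False
        using v(2)[of i] v(2)[of j] N by argo
    qed
    then show "\<exists>M. \<forall>m\<ge>M. \<forall>n\<ge>M. norm (v m - v n) < e" by blast
  qed
  then obtain p where p: "v \<longlonglongrightarrow> p"
    using Cauchy_convergent[of v] unfolding convergent_def by blast
  have "p \<in> D"
    using closed_sequentially[OF \<open>closed D\<close> v(1) p] .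
  have "(\<lambda>n. h (v n)) \<longlonglongrightarrow> h p"
    unfolding h_def by (intro tendsto_intros p)
  moreover have "(\<lambda>n. m + c n) \<longlonglongrightarrow> m + 0"
    by (intro tendsto_intros c)
  ultimately have "h p \<le> m + 0"
    by (rule LIMSEQ_le) (intro exI allI impI less_imp_le v(2))
  then have "h p \<le> h w" if "w \<in> D" for w
    using m_le[OF that] by simp
  then show ?thesis
    using that[OF \<open>p \<in> D\<close>] unfolding h_def by blast
qed

text \<open>Compare \<open>p\<close> with points \<open>w t\<close> of the segment to
  \<open>v\<close>. Nonnegativity of \<open>lyapunov p (w t)\<close> bounds the increase of the
  squared norm; divide by \<open>t\<close>, let \<open>t\<close> tend to 0 and use continuity of the
  duality mapping.\<close>

lemma norm_sq_minimizer_variational: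
  fixes p v :: "'a::real_normed_vector" and g :: "'a \<Rightarrow>\<^sub>L real"
  assumes smooth: "uniformly_smooth TYPE('a)" and "convex D" "p \<in> D" "v \<in> D"
    and min: "\<And>w. w \<in> D \<Longrightarrow> (norm p)\<^sup>2 - 2 * g p \<le> (norm w)\<^sup>2 - 2 * g w"
  shows "g (v - p) \<le> duality_map p (v - p)"
proof -
  define w where "w t = p + t *\<^sub>R (v - p)" for t :: real
  have "g (v - p) \<le> duality_map (w t) (v - p)" if "0 < t" "t < 1" for t
  proof -
    have "w t = (1 - t) *\<^sub>R p + t *\<^sub>R v" by (simp add: w_def algebra_simps)
    then have "w t \<in> D"
      using convexD_alt[OF \<open>convex D\<close> \<open>p \<in> D\<close> \<open>v \<in> D\<close>, of t] that by simp
    then have "2 * g (w t - p) \<le> (norm (w t))\<^sup>2 - (norm p)\<^sup>2"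
      using min[of "w t"] by (simp add: blinfun.diff_right)
    also have "\<dots> \<le> 2 * duality_map (w t) (w t - p)"
      using lyapunov_nonneg[OF smooth, of p "w t"]
      by (simp add: lyapunov_def blinfun.diff_right duality_map_self[OF smooth])
    finally show ?thesis
      using that by (simp add: w_def blinfun.scaleR_right)
  qed
  then have ev: "\<forall>\<^sub>F t in at_right 0. g (v - p) \<le> duality_map (w t) (v - p)"
    unfolding eventually_at_right_field by (intro exI[of _ 1]) simp
  have "((\<lambda>t. norm (p - w t)) \<longlongrightarrow> norm (p - (p + 0 *\<^sub>R (v - p)))) (at_right 0)"
    unfolding w_def by (intro tendsto_intros)
  then have "((\<lambda>t. norm (p - w t)) \<longlongrightarrow> 0) (at_right 0)" by simp
  then have "((\<lambda>t. norm (duality_map p - duality_map (w t))) \<longlongrightarrow> 0) (at_right 0)"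
    by (intro duality_map_diff_tendsto[OF smooth, where X = "\<lambda>_. p" and R = "norm p"]) simp_all
  then have "((\<lambda>t. duality_map (w t)) \<longlongrightarrow> duality_map p) (at_right 0)"
    by - (rule tendsto_dist_iff[THEN iffD2], simp add: dist_norm norm_minus_commute)
  then have "((\<lambda>t. duality_map (w t) (v - p)) \<longlongrightarrow> duality_map p (v - p)) (at_right 0)"
    by (intro tendsto_intros)
  then show ?thesis
    using ev by (rule tendsto_lowerbound) simp
qed

text \<open>Over the whole space the variational inequality holds for \<open>w\<close> and
  \<open>- w\<close>, hence is an equality. Surjectivity makes \<open>duality_inv\<close> a right
  inverse.\<close>

lemma surj_duality_map:
  assumes "uniformly_smooth TYPE('a::banach)" "uniformly_convex TYPE('a)"
  shows "surj (duality_map :: 'a \<Rightarrow> 'a \<Rightarrow>\<^sub>L real)"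
  unfolding surj_def
proof
  fix g :: "'a \<Rightarrow>\<^sub>L real"
  obtain p where p: "\<And>v. (norm p)\<^sup>2 - 2 * g p \<le> (norm v)\<^sup>2 - 2 * g v"
    using norm_sq_minimizer_exists[OF assms(2), of UNIV g] by auto
  have le: "g w \<le> duality_map p w" for w
    using norm_sq_minimizer_variational[OF assms(1), of UNIV p "w + p" g] p by simp
  have "duality_map p w = g w" for w
    using le[of w] le[of "- w"] by (simp add: blinfun.minus_right)
  then have "duality_map p = g"
    by (rule blinfun_eqI)
  then show "\<exists>p. g = duality_map p"
    by metis
qed

text \<open>The variational inequality at a minimizer gives the three-point estimate. Applied to a
  second minimizer \<open>p'\<close>, it gives \<open>lyapunov p' p \<le> 0\<close>, the uniqueness
  that \<open>THE\<close> requires.\<close>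

lemma gen_proj:
  fixes D :: "'a::banach set"
  assumes smooth: "uniformly_smooth TYPE('a)" and uc: "uniformly_convex TYPE('a)"
    and "closed D" "convex D" "D \<noteq> {}"
  shows gen_proj_in: "gen_proj D x \<in> D"
    and lyapunov_gen_proj: "v \<in> D \<Longrightarrow> lyapunov v (gen_proj D x) + lyapunov (gen_proj D x) x \<le> lyapunov v x"
proof -
  have three: "lyapunov v p + lyapunov p x \<le> lyapunov v x"
    if p: "is_arg_min (\<lambda>y. lyapunov y x) (\<lambda>y. y \<in> D) p" and v: "v \<in> D" for p v
  proof -
    have "p \<in> D" and min: "\<And>w. w \<in> D \<Longrightarrow> lyapunov p x \<le> lyapunov w x"
      using p unfolding is_arg_min_linorder by blast+
    have "(norm p)\<^sup>2 - 2 * duality_map x p \<le> (norm w)\<^sup>2 - 2 * duality_map x w" if "w \<in> D" for w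
      using min[OF that] by (simp add: lyapunov_def)
    with \<open>p \<in> D\<close> v have "duality_map x (v - p) \<le> duality_map p (v - p)"
      by (rule norm_sq_minimizer_variational[OF smooth \<open>convex D\<close>])
    then show ?thesis
      using lyapunov_three_point[OF smooth, of v p x] by (simp add: blinfun.diff_left)
  qed
  obtain p where "p \<in> D"
    "\<And>v. v \<in> D \<Longrightarrow> (norm p)\<^sup>2 - 2 * duality_map x p \<le> (norm v)\<^sup>2 - 2 * duality_map x v"
    using norm_sq_minimizer_exists[OF uc assms(3-5)] by blast
  then have p: "is_arg_min (\<lambda>y. lyapunov y x) (\<lambda>y. y \<in> D) p"
    by (simp add: is_arg_min_linorder lyapunov_def)
  have "is_arg_min (\<lambda>y. lyapunov y x) (\<lambda>y. y \<in> D) (gen_proj D x)"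
    unfolding gen_proj_def
  proof (rule theI[where P = "is_arg_min (\<lambda>y. lyapunov y x) (\<lambda>y. y \<in> D)"])
    show "is_arg_min (\<lambda>y. lyapunov y x) (\<lambda>y. y \<in> D) p" by (rule p)
    fix p' assume p': "is_arg_min (\<lambda>y. lyapunov y x) (\<lambda>y. y \<in> D) p'"
    then have "p' \<in> D" "lyapunov p' x \<le> lyapunov p x"
      using p unfolding is_arg_min_linorder by blast+
    then have "lyapunov p' p \<le> 0"
      using three[OF p, of p'] by simp
    then show "p' = p"
      by (rule lyapunov_eq_zero_imp_eq[OF smooth uc])
  qed
  note min = this
  then show "gen_proj D x \<in> D"
    unfolding is_arg_min_linorder by blast
  show "lyapunov v (gen_proj D x) + lyapunov (gen_proj D x) x \<le> lyapunov v x" if "v \<in> D"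
    using min that by (rule three)
qed

section \<open>The hybrid iteration\<close>

text \<open>In the resolvent inequality at \<open>p\<close>, (A2) and \<open>p \<in> EP C f\<close>
  make the \<open>f\<close> term nonpositive, so the pairing is nonnegative.\<close>

lemma EP_resolvent_lyapunov:
  fixes p x z :: "'a::real_normed_vector"
  assumes smooth: "uniformly_smooth TYPE('a)" and f: "equilibrium_bifunction (duality_map ` C) f"
    and "r > 0" and z: "is_EP_resolvent C f r x z" and p: "p \<in> EP C f"
  shows "lyapunov p z + lyapunov z x \<le> lyapunov p x"
proof -
  have "z \<in> C" "p \<in> C" using z p by (auto simp: is_EP_resolvent_def EP_def)
  then have "f (duality_map z) (duality_map p) + f (duality_map p) (duality_map z) \<le> 0"
    "0 \<le> f (duality_map p) (duality_map z)"
    "0 \<le> f (duality_map z) (duality_map p) + (1 / r) * (duality_map z - duality_map x) (p - z)"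
    using f z p by (auto simp: equilibrium_bifunction_def is_EP_resolvent_def EP_def)
  then have "0 \<le> (1 / r) * (duality_map z - duality_map x) (p - z)" by linarith
  then show ?thesis
    using \<open>r > 0\<close> lyapunov_three_point[OF smooth, of p z x] by (simp add: zero_le_divide_iff)
qed

text \<open>Monotonicity gives \<open>A z (p - z) \<le> A p (p - z)\<close>, which is nonpositive
  because \<open>p\<close> solves the variational inequality.\<close>

lemma VI_resolvent_lyapunov:
  fixes p x z :: "'a::real_normed_vector"
  assumes smooth: "uniformly_smooth TYPE('a)" and A: "monotone_mapping_on C A"
    and "r > 0" and z: "is_VI_resolvent C A r x z" and p: "p \<in> VI C A"
  shows "lyapunov p z + lyapunov z x \<le> lyapunov p x"
proof -
  have "z \<in> C" "p \<in> C" using z p by (auto simp: is_VI_resolvent_def VI_def)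
  then have "0 \<le> (A z - A p) (z - p)" "0 \<le> A p (z - p)"
    "0 \<le> A z (p - z) + (1 / r) * (duality_map z - duality_map x) (p - z)"
    using A z p by (auto simp: monotone_mapping_on_def is_VI_resolvent_def VI_def)
  then have "0 \<le> (1 / r) * (duality_map z - duality_map x) (p - z)"
    by (simp add: blinfun.diff_left blinfun.diff_right)
  then show ?thesis
    using \<open>r > 0\<close> lyapunov_three_point[OF smooth, of p z x] by (simp add: zero_le_divide_iff)
qed

text \<open>Monotonicity of the graph is applied at the resolvent point and at \<open>p\<close>,
  whose value is 0.\<close>

lemma op_resolvent_lyapunov:
  fixes p x z :: "'a::real_normed_vector"
  assumes smooth: "uniformly_smooth TYPE('a)" and M: "monotone_op M"
    and "r > 0" and z: "is_op_resolvent M r x z" and p: "p \<in> zeros M"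
  shows "lyapunov p z + lyapunov z x \<le> lyapunov p x"
proof -
  have "0 \<le> ((1 / r) *\<^sub>R (duality_map x - duality_map z) - 0) (z - p)"
    using M z p unfolding monotone_op_def is_op_resolvent_def zeros_def by blast
  then have "0 \<le> (duality_map x - duality_map z) (z - p)"
    using \<open>r > 0\<close> by (simp add: blinfun.scaleR_left zero_le_divide_iff)
  then show ?thesis
    using lyapunov_three_point[OF smooth, of p z x]
    by (simp add: blinfun.diff_left blinfun.diff_right)
qed

text \<open>Exhibits the functional as squared dual norm plus an affine function of
  \<open>g\<close>, hence convex in \<open>g\<close>.\<close>

lemma lyapunov_duality_inv:
  fixes p :: "'a::banach"
  assumes "uniformly_smooth TYPE('a)" "uniformly_convex TYPE('a)"
  shows "lyapunov p (duality_inv g) = (norm p)\<^sup>2 - 2 * g p + (norm g)\<^sup>2"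
  using norm_duality_map[OF assms(1), of "duality_inv g"]
  by (simp add: lyapunov_def surj_f_inv_f[OF surj_duality_map[OF assms]])

lemma lyapunov_duality_inv_sum_le:
  fixes p :: "'a::banach" and G :: "'i \<Rightarrow> 'a \<Rightarrow>\<^sub>L real"
  assumes smooth: "uniformly_smooth TYPE('a)" and uc: "uniformly_convex TYPE('a)"
    and "finite I" "\<And>i. i \<in> I \<Longrightarrow> 0 \<le> \<alpha> i" "sum \<alpha> I = 1"
  shows "lyapunov p (duality_inv (\<Sum>i\<in>I. \<alpha> i *\<^sub>R G i))
    \<le> (\<Sum>i\<in>I. \<alpha> i * lyapunov p (duality_inv (G i)))"
proof -
  have "norm (\<Sum>i\<in>I. \<alpha> i *\<^sub>R G i) \<le> (\<Sum>i\<in>I. \<alpha> i * norm (G i))"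
    using assms(4) by (intro sum_norm_le) auto
  then have "(norm (\<Sum>i\<in>I. \<alpha> i *\<^sub>R G i))\<^sup>2 \<le> (\<Sum>i\<in>I. \<alpha> i * norm (G i))\<^sup>2"
    by (rule power_mono) simp
  also have "\<dots> \<le> (\<Sum>i\<in>I. \<alpha> i * (norm (G i))\<^sup>2)"
  proof -
    have "I \<noteq> {}" using assms(5) by auto
    then show ?thesis
      using convex_on_sum[OF \<open>finite I\<close> _ convex_power2, of \<alpha> "\<lambda>i. norm (G i)"] assms(4,5) by simp
  qed
  finally have "(norm (\<Sum>i\<in>I. \<alpha> i *\<^sub>R G i))\<^sup>2 \<le> (\<Sum>i\<in>I. \<alpha> i * (norm (G i))\<^sup>2)" .
  moreover have "(norm p)\<^sup>2 = (\<Sum>i\<in>I. \<alpha> i * (norm p)\<^sup>2)"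
    using assms(5) by (simp flip: sum_distrib_right)
  ultimately show ?thesis
    unfolding lyapunov_duality_inv[OF smooth uc]
    by (simp add: blinfun.sum_left blinfun.scaleR_left algebra_simps sum.distrib sum_subtractf sum_distrib_left)
qed

text \<open>By convexity the new point costs at most the weighted average of the five terms. Each
  resolvent term saves its weight times \<open>lyapunov w x\<close>; the \<open>t\<close> term is
  bounded by \<open>lyapunov p x\<close> through \<open>q\<close>.\<close>

lemma hybrid_step_lyapunov:
  fixes p x z u q :: "'a::banach" and \<alpha> :: "nat \<Rightarrow> real"
  assumes smooth: "uniformly_smooth TYPE('a)" and uc: "uniformly_convex TYPE('a)"
    and \<alpha>: "\<forall>i\<in>{1..5}. 0 < \<alpha> i \<and> \<alpha> i < 1" "(\<Sum>i=1..5. \<alpha> i) = 1"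
    and z: "lyapunov p z + lyapunov z x \<le> lyapunov p x"
    and u: "lyapunov p u + lyapunov u x \<le> lyapunov p x"
    and q: "lyapunov p q + lyapunov q x \<le> lyapunov p x"
    and t: "lyapunov p (duality_inv t) \<le> lyapunov p q"
  shows "\<alpha> 2 * lyapunov z x + \<alpha> 3 * lyapunov u x + \<alpha> 4 * lyapunov q x
    \<le> lyapunov p x - lyapunov p (duality_inv
         (\<alpha> 1 *\<^sub>R duality_map x + \<alpha> 2 *\<^sub>R duality_map z + \<alpha> 3 *\<^sub>R duality_map u
          + \<alpha> 4 *\<^sub>R duality_map q + \<alpha> 5 *\<^sub>R t))"
    (is "_ \<le> _ - lyapunov p (duality_inv ?g)")
proof -
  define G where "G i = (if i = 1 then duality_map x else if i = 2 then duality_map z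
    else if i = 3 then duality_map u else if i = 4 then duality_map q else t)" for i :: nat
  have five: "{1..5::nat} = {1, 2, 3, 4, 5}" by auto
  have inv: "lyapunov p (duality_inv (duality_map w)) = lyapunov p w" for w
    unfolding lyapunov_duality_inv[OF smooth uc] by (simp add: lyapunov_def norm_duality_map[OF smooth])
  have sum: "\<alpha> 1 + \<alpha> 2 + \<alpha> 3 + \<alpha> 4 + \<alpha> 5 = 1"
    using \<alpha>(2) unfolding five by simp
  have pos: "0 < \<alpha> 2" "0 < \<alpha> 3" "0 < \<alpha> 4" "0 < \<alpha> 5"
    using \<alpha>(1) by auto
  have "lyapunov p (duality_inv (\<Sum>i\<in>{1..5}. \<alpha> i *\<^sub>R G i))
      \<le> (\<Sum>i\<in>{1..5}. \<alpha> i * lyapunov p (duality_inv (G i)))"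
    using bspec[OF \<alpha>(1)] by (intro lyapunov_duality_inv_sum_le[OF smooth uc] \<alpha>(2)) (simp_all add: less_imp_le)
  then have "lyapunov p (duality_inv ?g) \<le> \<alpha> 1 * lyapunov p x + \<alpha> 2 * lyapunov p z
      + \<alpha> 3 * lyapunov p u + \<alpha> 4 * lyapunov p q + \<alpha> 5 * lyapunov p (duality_inv t)"
    unfolding five by (simp add: G_def inv add.assoc)
  moreover have "\<alpha> 2 * lyapunov p z \<le> \<alpha> 2 * (lyapunov p x - lyapunov z x)"
    "\<alpha> 3 * lyapunov p u \<le> \<alpha> 3 * (lyapunov p x - lyapunov u x)"
    "\<alpha> 4 * lyapunov p q \<le> \<alpha> 4 * (lyapunov p x - lyapunov q x)"
    using z u q pos by (simp_all add: mult_left_mono)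
  moreover have "\<alpha> 5 * lyapunov p (duality_inv t) \<le> \<alpha> 5 * lyapunov p x"
    using t q lyapunov_nonneg[OF smooth, of q x] pos by (intro mult_left_mono) auto
  moreover have "\<alpha> 1 * lyapunov p x = lyapunov p x - \<alpha> 2 * lyapunov p x - \<alpha> 3 * lyapunov p x
      - \<alpha> 4 * lyapunov p x - \<alpha> 5 * lyapunov p x"
  proof -
    have "\<alpha> 1 = 1 - \<alpha> 2 - \<alpha> 3 - \<alpha> 4 - \<alpha> 5" using sum by simp
    then show ?thesis by (simp add: left_diff_distrib)
  qed
  ultimately show ?thesis by (simp add: right_diff_distrib)
qed

text \<open>The term \<open>(norm v)\<^sup>2\<close> cancels, leaving an affine inequality in
  \<open>v\<close>.\<close>

lemma lyapunov_halfspace: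
  fixes x y :: "'a::real_normed_vector"
  shows "closed {v. lyapunov v y \<le> lyapunov v x}" "convex {v. lyapunov v y \<le> lyapunov v x}"
proof -
  let ?g = "duality_map x - duality_map y" and ?b = "((norm x)\<^sup>2 - (norm y)\<^sup>2) / 2"
  have eq: "{v. lyapunov v y \<le> lyapunov v x} = {v. ?g v \<le> ?b}"
    by (auto simp: lyapunov_def blinfun.diff_left)
  show "closed {v. lyapunov v y \<le> lyapunov v x}"
    unfolding eq by (intro closed_Collect_le continuous_intros)
  have "convex (blinfun_apply ?g -` {..?b})"
    by (intro convex_linear_vimage convex_real_interval blinfun.bounded_linear_right
        bounded_linear.linear)
  then show "convex {v. lyapunov v y \<le> lyapunov v x}"
    unfolding eq by (simp add: vimage_def)
qed

theorem proposition3p3: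
  fixes C B :: "'a::banach set"
    and f :: "nat \<Rightarrow> ('a \<Rightarrow>\<^sub>L real) \<Rightarrow> ('a \<Rightarrow>\<^sub>L real) \<Rightarrow> real"
    and A :: "nat \<Rightarrow> 'a \<Rightarrow> ('a \<Rightarrow>\<^sub>L real)"
    and M :: "nat \<Rightarrow> 'a \<Rightarrow> ('a \<Rightarrow>\<^sub>L real) set"
    and T :: "nat \<Rightarrow> 'a \<Rightarrow> ('a \<Rightarrow>\<^sub>L real)"
    and \<Gamma> :: "('a \<Rightarrow> ('a \<Rightarrow>\<^sub>L real)) set"
    and \<sigma> \<tau> \<rho> :: "nat \<Rightarrow> nat"
    and r \<alpha> :: "nat \<Rightarrow> real"
    and a :: real
    and x0 :: 'a
    and x z u q y :: "nat \<Rightarrow> 'a"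
    and Cs :: "nat \<Rightarrow> 'a set"
  assumes "uniformly_smooth TYPE('a)" and "uniformly_convex TYPE('a)"
    and "C \<noteq> {}" and "closed C" and "convex C"
    and "closed (duality_map ` C)" and "convex (duality_map ` C)"
    and "\<forall>i\<ge>1. equilibrium_bifunction (duality_map ` C) (f i)"
    and "\<forall>j\<ge>1. continuous_on C (A j) \<and> monotone_mapping_on C (A j)"
    and "\<forall>k\<ge>1. maximal_monotone_op (M k)"
    and EP_resolvent_wd: "\<forall>i\<ge>1. \<forall>s>0. \<forall>w. \<exists>!v. is_EP_resolvent C (f i) s w v"
    and VI_resolvent_wd: "\<forall>j\<ge>1. \<forall>s>0. \<forall>w. \<exists>!v. is_VI_resolvent C (A j) s w v"
    and op_resolvent_wd: "\<forall>k\<ge>1. \<forall>s>0. \<forall>w. \<exists>!v. is_op_resolvent (M k) s w v"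
    and "\<forall>k\<ge>1. \<forall>s>0. op_resolvent (M k) s ` C \<subseteq> C"
    and "\<forall>n\<ge>1. gen_J_nonexpansive C (T n)"
    and "\<forall>S\<in>\<Gamma>. J_closed C S \<and> gen_J_nonexpansive C S"
    and "(\<Inter>n\<in>{1..}. J_fixed C (T n)) = J_fixed_family C \<Gamma>"
    and "J_fixed_family C \<Gamma> \<noteq> {}"
    and "\<forall>n\<ge>1. \<sigma> n \<ge> 1" and "\<forall>i\<ge>1. infinite {n. n \<ge> 1 \<and> \<sigma> n = i}"
    and "\<forall>n\<ge>1. \<tau> n \<ge> 1" and "\<forall>j\<ge>1. infinite {n. n \<ge> 1 \<and> \<tau> n = j}"
    and "\<forall>n\<ge>1. \<rho> n \<ge> 1" and "\<forall>k\<ge>1. infinite {n. n \<ge> 1 \<and> \<rho> n = k}"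
    and "B = J_fixed_family C \<Gamma> \<inter> (\<Inter>i\<in>{1..}. EP C (f i))
              \<inter> (\<Inter>j\<in>{1..}. VI C (A j)) \<inter> (\<Inter>k\<in>{1..}. zeros (M k))"
    and "B \<noteq> {}" and "closed B" and "convex B"
    and "a > 0" and "\<forall>n\<ge>1. r n \<ge> a"
    and "\<forall>i\<in>{1..5}. 0 < \<alpha> i \<and> \<alpha> i < 1" and "(\<Sum>i=1..5. \<alpha> i) = 1"
    and "x0 \<in> C" and "x 1 = x0" and "Cs 1 = C"
    and "\<forall>n\<ge>1. z n = EP_resolvent C (f (\<sigma> n)) (r n) (x n)"
    and "\<forall>n\<ge>1. u n = VI_resolvent C (A (\<tau> n)) (r n) (x n)"
    and "\<forall>n\<ge>1. q n = op_resolvent (M (\<rho> n)) (r n) (x n)"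
    and "\<forall>n\<ge>1. y n = duality_inv
           (\<alpha> 1 *\<^sub>R duality_map (x n) + \<alpha> 2 *\<^sub>R duality_map (z n) + \<alpha> 3 *\<^sub>R duality_map (u n)
            + \<alpha> 4 *\<^sub>R duality_map (q n) + \<alpha> 5 *\<^sub>R T n (q n))"
    and "\<forall>n\<ge>1. Cs (n + 1) = {v \<in> Cs n. lyapunov v (y n) \<le> lyapunov v (x n)}"
    and "\<forall>n\<ge>1. x (n + 1) = gen_proj (Cs (n + 1)) x0"
    and "NST_condition C T \<Gamma>"
  shows "((\<lambda>n. norm (x n - z n)) \<longlonglongrightarrow> 0) \<and>
         ((\<lambda>n. norm (x n - u n)) \<longlonglongrightarrow> 0) \<and>
         ((\<lambda>n. norm (x n - q n)) \<longlonglongrightarrow> 0) \<and>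
         ((\<lambda>n. norm (duality_map (q n) - T n (q n))) \<longlonglongrightarrow> 0) \<and>
         (\<forall>i\<ge>1. \<forall>nl. strict_mono nl \<and> (\<forall>l. nl l \<ge> 1 \<and> \<sigma> (nl l) = i) \<longrightarrow>
           (\<lambda>l. norm (duality_map (z (nl l)) - duality_map (x (nl l))) / r (nl l)) \<longlonglongrightarrow> 0) \<and>
         (\<forall>j\<ge>1. \<forall>ml. strict_mono ml \<and> (\<forall>l. ml l \<ge> 1 \<and> \<tau> (ml l) = j) \<longrightarrow>
           (\<lambda>l. norm (duality_map (u (ml l)) - duality_map (x (ml l))) / r (ml l)) \<longlonglongrightarrow> 0) \<and>
         (\<forall>k\<ge>1. \<forall>sl. strict_mono sl \<and> (\<forall>l. sl l \<ge> 1 \<and> \<rho> (sl l) = k) \<longrightarrow>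
           (\<lambda>l. norm (duality_map (x (sl l)) - duality_map (q (sl l))) / r (sl l)) \<longlonglongrightarrow> 0)"
proof -

  \<comment> \<open>Resolvent points and the key estimate\<close>
  note smooth = assms(1) and uc = assms(2)
  have r: "0 < r n" "a \<le> r n" if "n \<ge> 1" for n
    using assms(29,30) that by fastforce+
  have z: "is_EP_resolvent C (f (\<sigma> n)) (r n) (x n) (z n)" if "n \<ge> 1" for n
    using theI'[of "is_EP_resolvent C (f (\<sigma> n)) (r n) (x n)"] EP_resolvent_wd assms(19,36) r(1) that
    by (simp add: EP_resolvent_def)
  have u: "is_VI_resolvent C (A (\<tau> n)) (r n) (x n) (u n)" if "n \<ge> 1" for n
    using theI'[of "is_VI_resolvent C (A (\<tau> n)) (r n) (x n)"] VI_resolvent_wd assms(21,37) r(1) that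
    by (simp add: VI_resolvent_def)
  have q: "is_op_resolvent (M (\<rho> n)) (r n) (x n) (q n)" if "n \<ge> 1" for n
    using theI'[of "is_op_resolvent (M (\<rho> n)) (r n) (x n)"] op_resolvent_wd assms(23,38) r(1) that
    by (simp add: op_resolvent_def)
  have qC: "q n \<in> C" if "n \<ge> 1" "x n \<in> C" for n
    using assms(14,23,38) r(1) that by (auto simp: image_subset_iff)
  \<comment> \<open>Used twice: its sign keeps \<open>B\<close> inside the sets \<open>Cs n\<close>,
    and its size later forces the resolvent distances to 0.\<close>
  have key: "\<alpha> 2 * lyapunov (z n) (x n) + \<alpha> 3 * lyapunov (u n) (x n) + \<alpha> 4 * lyapunov (q n) (x n)
      \<le> lyapunov p (x n) - lyapunov p (y n)" if n: "n \<ge> 1" and xn: "x n \<in> C" and p: "p \<in> B" for n p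
  proof -
    have idx: "\<sigma> n \<ge> 1" "\<tau> n \<ge> 1" "\<rho> n \<ge> 1" using assms(19,21,23) n by auto
    have pB: "p \<in> J_fixed_family C \<Gamma>" "p \<in> EP C (f (\<sigma> n))" "p \<in> VI C (A (\<tau> n))" "p \<in> zeros (M (\<rho> n))"
      using p idx unfolding assms(25) by auto
    then have "p \<in> J_fixed C (T n)"
      using n unfolding assms(17)[symmetric] by blast
    then have t: "lyapunov p (duality_inv (T n (q n))) \<le> lyapunov p (q n)"
      using assms(15) n qC[OF n xn] unfolding gen_J_nonexpansive_def by blast
    have y: "y n = duality_inv
           (\<alpha> 1 *\<^sub>R duality_map (x n) + \<alpha> 2 *\<^sub>R duality_map (z n) + \<alpha> 3 *\<^sub>R duality_map (u n)
            + \<alpha> 4 *\<^sub>R duality_map (q n) + \<alpha> 5 *\<^sub>R T n (q n))"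
      using assms(39) n by blast
    have "equilibrium_bifunction (duality_map ` C) (f (\<sigma> n))" "monotone_mapping_on C (A (\<tau> n))"
      "monotone_op (M (\<rho> n))"
      using assms(8-10) idx unfolding maximal_monotone_op_def by blast+
    then show ?thesis
      unfolding y using pB r(1)[OF n] z[OF n] u[OF n] q[OF n] t
      by (intro hybrid_step_lyapunov[OF smooth uc assms(31,32)] EP_resolvent_lyapunov[OF smooth]
          VI_resolvent_lyapunov[OF smooth] op_resolvent_lyapunov[OF smooth])
  qed

  \<comment> \<open>Invariants of the nested sets\<close>
  obtain p where p: "p \<in> B" using assms(26) by blast
  have pos: "0 < \<alpha> 2" "0 < \<alpha> 3" "0 < \<alpha> 4" "0 < \<alpha> 5"
    using assms(31) by auto
  \<comment> \<open>Membership of \<open>x n\<close> belongs to the invariant because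
    \<open>key\<close> needs \<open>x n \<in> C\<close>; the inclusion of \<open>B\<close> keeps the
    next set nonempty, so that its projection exists.\<close>
  have inv: "Cs n \<subseteq> C \<and> closed (Cs n) \<and> convex (Cs n) \<and> B \<subseteq> Cs n \<and> x n \<in> Cs n" if "n \<ge> 1" for n
    using that
  proof (induction n rule: nat_induct_at_least)
    case base
    have "B \<subseteq> C" unfolding assms(25) EP_def by auto
    then show ?case using assms(4,5,33-35) by simp
  next
    case (Suc n)
    have C: "Cs (Suc n) = Cs n \<inter> {v. lyapunov v (y n) \<le> lyapunov v (x n)}"
      using assms(40) Suc.hyps by auto
    have "lyapunov w (y n) \<le> lyapunov w (x n)" if "w \<in> B" for w
    proof -
      have "0 \<le> \<alpha> 2 * lyapunov (z n) (x n) + \<alpha> 3 * lyapunov (u n) (x n) + \<alpha> 4 * lyapunov (q n) (x n)"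
        using pos lyapunov_nonneg[OF smooth] by simp
      then show ?thesis using key[OF Suc.hyps _ that] Suc.IH by fastforce
    qed
    then have B: "B \<subseteq> Cs (Suc n)" using Suc.IH C by auto
    have cc: "closed (Cs (Suc n))" "convex (Cs (Suc n))"
      unfolding C using Suc.IH by (simp_all add: closed_Int convex_Int lyapunov_halfspace)
    have "x (Suc n) \<in> Cs (Suc n)"
      using gen_proj_in[OF smooth uc cc] B p assms(41) Suc.hyps by auto
    then show ?case using B cc C Suc.IH by auto
  qed
  have xC: "x n \<in> C" if "n \<ge> 1" for n using inv[OF that] by blast

  \<comment> \<open>Asymptotic regularity of the iterates\<close>
  have proj: "lyapunov v (x n) + lyapunov (x n) x0 \<le> lyapunov v x0" if n: "n \<ge> 1" and v: "v \<in> Cs n" for n v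
  proof (cases "n = 1")
    \<comment> \<open>The first iterate is not defined as a projection, but it equals
      \<open>x0\<close>, so the claim reduces to \<open>lyapunov x0 x0 = 0\<close>.\<close>
    case True
    then show ?thesis using assms(34) by (simp add: lyapunov_self[OF smooth])
  next
    case False
    then have "x n = gen_proj (Cs n) x0"
      using assms(41)[rule_format, of "n - 1"] n by simp
    then show ?thesis
      using lyapunov_gen_proj[OF smooth uc _ _ _ v] inv[OF n] v by auto
  qed
  have step: "lyapunov (x (Suc n)) (x n) \<le> lyapunov (x (Suc n)) x0 - lyapunov (x n) x0" if "n \<ge> 1" for n
  proof -
    have "x (Suc n) \<in> Cs n" using inv[of "Suc n"] assms(40) that by auto
    then show ?thesis using proj[OF that] by fastforce
  qed
  have bdd: "lyapunov (x n) x0 \<le> lyapunov p x0" if "n \<ge> 1" for n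
    using proj[OF that, of p] inv[OF that] p lyapunov_nonneg[OF smooth, of p "x n"] by auto
  define R where "R = norm x0 + sqrt (lyapunov p x0)"
  have R: "\<forall>\<^sub>F n in sequentially. norm (x n) \<le> R"
  proof (rule eventually_sequentiallyI)
    fix n :: nat assume "1 \<le> n"
    then have "(norm (x n) - norm x0)\<^sup>2 \<le> lyapunov p x0"
      using lyapunov_ge_norm_diff_sq[OF smooth, of "x n" x0] bdd[of n] by linarith
    then have "norm (x n) - norm x0 \<le> sqrt (lyapunov p x0)" by (rule real_le_rsqrt)
    then show "norm (x n) \<le> R" by (simp add: R_def)
  qed
  \<comment> \<open>The shift by one makes \<open>s\<close> monotone from index 0 on, since the
    iteration is specified only from index 1; \<open>LIMSEQ_imp_Suc\<close> undoes it below.\<close>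
  define s where "s n = lyapunov (x (Suc n)) x0" for n
  have "incseq s"
  proof (rule incseq_SucI)
    fix n
    show "s n \<le> s (Suc n)"
      using step[of "Suc n"] lyapunov_nonneg[OF smooth, of "x (Suc (Suc n))" "x (Suc n)"] by (simp add: s_def)
  qed
  then obtain L where L: "s \<longlonglongrightarrow> L"
  proof (rule incseq_convergent)
    show "\<forall>n. s n \<le> lyapunov p x0" using bdd by (simp add: s_def)
  qed blast
  have "(\<lambda>n. s (Suc n) - s n) \<longlonglongrightarrow> L - L"
    by (intro tendsto_diff LIMSEQ_Suc L)
  then have s0: "(\<lambda>n. s (Suc n) - s n) \<longlonglongrightarrow> 0" by simp
  have "(\<lambda>n. lyapunov (x (Suc (Suc n))) (x (Suc n))) \<longlonglongrightarrow> 0"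
    by (rule tendsto_sandwich[OF _ _ tendsto_const s0])
      (use step lyapunov_nonneg[OF smooth] in \<open>simp_all add: s_def\<close>)
  then have succ: "(\<lambda>n. lyapunov (x (Suc n)) (x n)) \<longlonglongrightarrow> 0"
    by (rule LIMSEQ_imp_Suc)
  have R_Suc: "\<forall>\<^sub>F n in sequentially. norm (x (Suc n)) \<le> R"
    using R by (rule eventually_compose_filterlim[OF _ filterlim_Suc])
  have xx: "(\<lambda>n. norm (x (Suc n) - x n)) \<longlonglongrightarrow> 0"
    by (rule lyapunov_tendsto_zero_imp[OF smooth uc eventually_mono[OF R_Suc] succ]) blast
  \<comment> \<open>\<open>x (Suc n)\<close> lies in \<open>Cs (Suc n)\<close>, whose defining
    inequality compares \<open>y n\<close> with \<open>x n\<close>.\<close>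
  have "(\<lambda>n. lyapunov (x (Suc n)) (y n)) \<longlonglongrightarrow> 0"
  proof (rule tendsto_sandwich[OF _ _ tendsto_const succ])
    show "\<forall>\<^sub>F n in sequentially. 0 \<le> lyapunov (x (Suc n)) (y n)"
      using lyapunov_nonneg[OF smooth] by simp
    show "\<forall>\<^sub>F n in sequentially. lyapunov (x (Suc n)) (y n) \<le> lyapunov (x (Suc n)) (x n)"
    proof (rule eventually_sequentiallyI)
      fix n :: nat assume "1 \<le> n"
      then show "lyapunov (x (Suc n)) (y n) \<le> lyapunov (x (Suc n)) (x n)"
        using inv[of "Suc n"] assms(40) by auto
    qed
  qed
  then have xy': "(\<lambda>n. norm (x (Suc n) - y n)) \<longlonglongrightarrow> 0"
    by (rule lyapunov_tendsto_zero_imp[OF smooth uc eventually_mono[OF R_Suc], rotated]) blast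
  have xy: "(\<lambda>n. norm (x n - y n)) \<longlonglongrightarrow> 0"
  proof -
    have "(\<lambda>n. (x (Suc n) - y n) - (x (Suc n) - x n)) \<longlonglongrightarrow> 0 - 0"
      using xx xy' by (intro tendsto_diff) (auto intro: tendsto_norm_zero_cancel)
    then show ?thesis by (simp add: tendsto_norm_zero)
  qed

  \<comment> \<open>Distances to the resolvent points\<close>
  have gap: "(\<lambda>n. lyapunov p (x n) - lyapunov p (y n)) \<longlonglongrightarrow> 0"
    by (rule lyapunov_diff_tendsto[OF smooth R xy])
  have dist_zero: "(\<lambda>n. norm (x n - w n)) \<longlonglongrightarrow> 0"
    if w: "\<And>n. n \<ge> 1 \<Longrightarrow> \<beta> * lyapunov (w n) (x n) \<le> lyapunov p (x n) - lyapunov p (y n)"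
      and "\<beta> > 0" for w \<beta>
  proof -
    have "(\<lambda>n. (lyapunov p (x n) - lyapunov p (y n)) / \<beta>) \<longlonglongrightarrow> 0"
      using tendsto_divide[OF gap tendsto_const, of \<beta>] \<open>\<beta> > 0\<close> by simp
    then have "(\<lambda>n. lyapunov (w n) (x n)) \<longlonglongrightarrow> 0"
    proof (rule tendsto_sandwich[rotated -1, of _ _ _ "\<lambda>_. 0"])
      show "\<forall>\<^sub>F n in sequentially. lyapunov (w n) (x n) \<le> (lyapunov p (x n) - lyapunov p (y n)) / \<beta>"
        using w \<open>\<beta> > 0\<close> by (intro eventually_sequentiallyI[of 1]) (simp add: pos_le_divide_eq mult.commute)
    qed (simp_all add: lyapunov_nonneg[OF smooth])
    then have "(\<lambda>n. norm (w n - x n)) \<longlonglongrightarrow> 0"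
      by (rule lyapunov_tendsto_zero_imp[OF smooth uc eventually_mono[OF R], rotated]) blast
    then show ?thesis by (simp add: norm_minus_commute)
  qed
  have nonneg: "0 \<le> \<alpha> 2 * lyapunov (z n) (x n)" "0 \<le> \<alpha> 3 * lyapunov (u n) (x n)"
    "0 \<le> \<alpha> 4 * lyapunov (q n) (x n)" for n
    using pos lyapunov_nonneg[OF smooth] by simp_all
  have xz: "(\<lambda>n. norm (x n - z n)) \<longlonglongrightarrow> 0"
  proof (rule dist_zero[OF _ pos(1)])
    show "\<alpha> 2 * lyapunov (z n) (x n) \<le> lyapunov p (x n) - lyapunov p (y n)" if "n \<ge> 1" for n
      using key[OF that xC[OF that] p] nonneg[of n] by linarith
  qed
  have xu: "(\<lambda>n. norm (x n - u n)) \<longlonglongrightarrow> 0"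
  proof (rule dist_zero[OF _ pos(2)])
    show "\<alpha> 3 * lyapunov (u n) (x n) \<le> lyapunov p (x n) - lyapunov p (y n)" if "n \<ge> 1" for n
      using key[OF that xC[OF that] p] nonneg[of n] by linarith
  qed
  have xq: "(\<lambda>n. norm (x n - q n)) \<longlonglongrightarrow> 0"
  proof (rule dist_zero[OF _ pos(3)])
    show "\<alpha> 4 * lyapunov (q n) (x n) \<le> lyapunov p (x n) - lyapunov p (y n)" if "n \<ge> 1" for n
      using key[OF that xC[OF that] p] nonneg[of n] by linarith
  qed

  \<comment> \<open>Limits in the dual space\<close>
  note J = duality_map_diff_tendsto[OF smooth R]
  have Jq: "(\<lambda>n. norm (duality_map (q n) - T n (q n))) \<longlonglongrightarrow> 0"
  proof -
    define D where "D w n = duality_map (x n) - duality_map (w n)" for w n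
    have D: "D w \<longlonglongrightarrow> 0" if "(\<lambda>n. norm (x n - w n)) \<longlonglongrightarrow> 0" for w
      using tendsto_norm_zero_cancel[OF J[OF that]] unfolding D_def .
    \<comment> \<open>This is the definition of \<open>y n\<close> solved for
      \<open>duality_map (q n) - T n (q n)\<close>. As the weights sum to 1, only differences from
      \<open>duality_map (x n)\<close> remain; \<open>q\<close> has weight
      \<open>\<alpha> 4 + \<alpha> 5\<close> because \<open>duality_map (q n)\<close> also replaces
      \<open>T n (q n)\<close>.\<close>
    have "(\<lambda>n. (1 / \<alpha> 5) *\<^sub>R (D y n - \<alpha> 2 *\<^sub>R D z n - \<alpha> 3 *\<^sub>R D u n - (\<alpha> 4 + \<alpha> 5) *\<^sub>R D q n))
        \<longlonglongrightarrow> (1 / \<alpha> 5) *\<^sub>R (0 - \<alpha> 2 *\<^sub>R 0 - \<alpha> 3 *\<^sub>R 0 - (\<alpha> 4 + \<alpha> 5) *\<^sub>R 0)"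
      by (intro tendsto_intros D xy xz xu xq)
    then have "(\<lambda>n. (1 / \<alpha> 5) *\<^sub>R (D y n - \<alpha> 2 *\<^sub>R D z n - \<alpha> 3 *\<^sub>R D u n - (\<alpha> 4 + \<alpha> 5) *\<^sub>R D q n))
        \<longlonglongrightarrow> 0" by simp
    moreover have "(1 / \<alpha> 5) *\<^sub>R (D y n - \<alpha> 2 *\<^sub>R D z n - \<alpha> 3 *\<^sub>R D u n - (\<alpha> 4 + \<alpha> 5) *\<^sub>R D q n)
        = duality_map (q n) - T n (q n)" if "n \<ge> 1" for n
    proof -
      have "{1..5::nat} = {1, 2, 3, 4, 5}" by auto
      then have a1: "\<alpha> 1 = 1 - \<alpha> 2 - \<alpha> 3 - \<alpha> 4 - \<alpha> 5" using assms(32) by simp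
      have "duality_map (y n) = \<alpha> 1 *\<^sub>R duality_map (x n) + \<alpha> 2 *\<^sub>R duality_map (z n)
          + \<alpha> 3 *\<^sub>R duality_map (u n) + \<alpha> 4 *\<^sub>R duality_map (q n) + \<alpha> 5 *\<^sub>R T n (q n)"
        using assms(39) that surj_f_inv_f[OF surj_duality_map[OF smooth uc]] by simp
      then have "D y n - \<alpha> 2 *\<^sub>R D z n - \<alpha> 3 *\<^sub>R D u n - (\<alpha> 4 + \<alpha> 5) *\<^sub>R D q n
          = \<alpha> 5 *\<^sub>R (duality_map (q n) - T n (q n))"
        unfolding D_def a1 by (simp add: algebra_simps)
      then show ?thesis using pos(4) by simp
    qed
    then have "\<forall>\<^sub>F n in sequentially.
        (1 / \<alpha> 5) *\<^sub>R (D y n - \<alpha> 2 *\<^sub>R D z n - \<alpha> 3 *\<^sub>R D u n - (\<alpha> 4 + \<alpha> 5) *\<^sub>R D q n)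
        = duality_map (q n) - T n (q n)"
      by (rule eventually_sequentiallyI)
    ultimately have "(\<lambda>n. duality_map (q n) - T n (q n)) \<longlonglongrightarrow> 0"
      by (rule Lim_transform_eventually)
    then show ?thesis by (rule tendsto_norm_zero)
  qed
  \<comment> \<open>Since \<open>r n \<ge> a > 0\<close>, the quotient is dominated by the one with
    denominator \<open>a\<close>. The limit holds along the whole sequence and passes to each
    subsequence.\<close>
  have div: "(\<lambda>n. norm (duality_map (x n) - duality_map (w n)) / r n) \<longlonglongrightarrow> 0"
    if "(\<lambda>n. norm (x n - w n)) \<longlonglongrightarrow> 0" for w
  proof -
    have "(\<lambda>n. norm (duality_map (x n) - duality_map (w n)) / a) \<longlonglongrightarrow> 0"
      using tendsto_divide[OF J[OF that] tendsto_const, of a] assms(29) by simp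
    then show ?thesis
    proof (rule tendsto_sandwich[rotated -1, of _ _ _ "\<lambda>_. 0"])
      show "\<forall>\<^sub>F n in sequentially. 0 \<le> norm (duality_map (x n) - duality_map (w n)) / r n"
        using r by (intro eventually_sequentiallyI[of 1]) (simp add: less_imp_le)
      show "\<forall>\<^sub>F n in sequentially. norm (duality_map (x n) - duality_map (w n)) / r n
          \<le> norm (duality_map (x n) - duality_map (w n)) / a"
        using r assms(29) by (intro eventually_sequentiallyI[of 1] divide_left_mono) auto
    qed simp
  qed
  have sub: "(\<lambda>l. norm (duality_map (x (nl l)) - duality_map (w (nl l))) / r (nl l)) \<longlonglongrightarrow> 0"
    if "(\<lambda>n. norm (x n - w n)) \<longlonglongrightarrow> 0" "strict_mono nl" for w nl
    using LIMSEQ_subseq_LIMSEQ[OF div[OF that(1)] that(2)] by (simp add: o_def)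
  show ?thesis
    using xz xu xq Jq sub[OF xz] sub[OF xu] sub[OF xq]
    by (simp add: norm_minus_commute[of "duality_map (z _)"] norm_minus_commute[of "duality_map (u _)"])
qed

end
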